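(* Let $(W,S)$ be a Coxeter system of finite rank $n$ with set of reflections $T$, let $(s_1,\dots,s_n)$ be an ordering of $S$ and let $h=s_1s_2\cdots s_n$. If $(W,(s_1,\dots,s_n))$ is well-stabilized and $(W,T,h)$ is pan-transitive, then the groups $\mathrm{Art}(W,S)$ and $\mathrm{Art}^*(W,T,h)$ are isomorphic.
   Context: A Coxeter system $(W,S)$: $W=\langle S\mid (ss')^{m(s,s')}=1\text{ whenever } m(s,s')\neq\infty\rangle$ where $m$ is symmetric, $m(s,s)=1$ and $m(s,s')\in\{2,3,\dots\}\cup\{\infty\}$ for $s\ne s'$. The set of reflections $T$ is the set of all conjugates in $W$ of elements of $S$. For a group $G$ with generating set $X$ and $a\in G$: $\ell_X(a)$ is the minimal $k$ such that $a=x_1\cdots x_k$ with each $x_i\in X\cup X^{-1}$; $\mathrm{Red}_X(a)$ is the set of such $k$-tuples $(x_1,\dots,x_k)$ with $k=\ell_X(a)$; $a\le_X b$ iff $\ell_X(a)+\ell_X(a^{-1}b)=\ell_X(b)$; $[1,b]_X=\{a\in G: a\le_X b\}$. The braid group $B_k=\langle\sigma_1,\dots,\sigma_{k-1}\mid \sigma_i\sigma_{i+1}\sigma_i=\sigma_{i+1}\sigma_i\sigma_{i+1},\ \sigma_i\sigma_j=\sigma_j\sigma_i\ (|i-j|\ge2)\rangle$ acts on $G^k$ (Hurwitz action) by $\sigma_i\cdot(g_1,\dots,g_k)=(g_1,\dots,g_{i-1},g_ig_{i+1}g_i^{-1},g_i,g_{i+2},\dots,g_k)$, $\sigma_i^{-1}\cdot(g_1,\dots,g_k)=(g_1,\dots,g_{i-1},g_{i+1},g_{i+1}^{-1}g_ig_{i+1},g_{i+2},\dots,g_k)$;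 when $X$ is closed under conjugation this preserves $\mathrm{Red}_X(a)$ for $k=\ell_X(a)$. The (standard) Artin group $\mathrm{Art}(W,S)$ is generated by $\bar s_1,\dots,\bar s_n$ subject to $[\bar s_i|\bar s_j]_{m}=[\bar s_j|\bar s_i]_{m}$ for all $i<j$ with $m=m(s_i,s_j)\neq\infty$, where $[a|b]_m$ denotes the alternating product $aba\cdots$ with $m$ factors. The dual Artin group $\mathrm{Art}^*(W,T,h)$ is generated by symbols $\{t\}$, $t\in T\cap[1,h]_T$, subject to $\{t_1\}\cdots\{t_k\}=\{t_1'\}\cdots\{t_k'\}$ for every $a\in[1,h]_T$ and all $(t_1,\dots,t_k),(t'_1,\dots,t'_k)\in\mathrm{Red}_T(a)$. Let $H\le B_n$ be the stabilizer of $(s_1,\dots,s_n)\in W^n$ and $\bar H\le B_n$ the stabilizer of $(\bar s_1,\dots,\bar s_n)\in\mathrm{Art}(W,S)^n$ under the Hurwitz action. $(W,(s_1,\dots,s_n))$ is called well-stabilized if $H=\bar H$. $(W,T,h)$ is called pan-transitive if for every $a\in[1,h]_T$ the Hurwitz action of $B_{\ell_T(a)}$ on $\mathrm{Red}_T(a)$ is transitive. *)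

theory Defs
  imports "HOL-Algebra.Algebra" "HOL-Library.Extended_Nat"
begin

text \<open>A word over generators of type 'a: a letter (x, True) stands for x, (x, False) for x^-1.\<close>
type_synonym 'a word = "('a \<times> bool) list"

inductive pres_eq :: "('a word \<times> 'a word) set \<Rightarrow> 'a word \<Rightarrow> 'a word \<Rightarrow> bool"
  for R where
  pe_refl: "pres_eq R w w"
| pe_sym: "pres_eq R u v \<Longrightarrow> pres_eq R v u"
| pe_trans: "pres_eq R u v \<Longrightarrow> pres_eq R v w \<Longrightarrow> pres_eq R u w"
| pe_cancel: "pres_eq R (u @ [(x, b), (x, \<not> b)] @ v) (u @ v)"
| pe_rel: "(l, r) \<in> R \<Longrightarrow> pres_eq R (u @ l @ v) (u @ r @ v)"

definition pclass :: "'a set \<Rightarrow> ('a word \<times> 'a word) set \<Rightarrow> 'a word \<Rightarrow> 'a word set" where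
  "pclass Xs R w = {v \<in> lists (Xs \<times> UNIV). pres_eq R w v}"

definition pres_group :: "'a set \<Rightarrow> ('a word \<times> 'a word) set \<Rightarrow> ('a word set) monoid" where
  "pres_group Xs R =
     \<lparr> carrier = {pclass Xs R w | w. w \<in> lists (Xs \<times> UNIV)},
       monoid.mult = (\<lambda>A B. {v \<in> lists (Xs \<times> UNIV). \<exists>u\<in>A. \<exists>u'\<in>B. pres_eq R (u @ u') v}),
       one = pclass Xs R [] \<rparr>"

definition coxeter_matrix :: "nat \<Rightarrow> (nat \<Rightarrow> nat \<Rightarrow> enat) \<Rightarrow> bool" where
  "coxeter_matrix n m \<longleftrightarrow>
     (\<forall>i<n. \<forall>j<n. m i j = m j i) \<and> (\<forall>i<n. m i i = 1) \<and>
     (\<forall>i<n. \<forall>j<n. i \<noteq> j \<longrightarrow> 2 \<le> m i j)"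

definition coxeter_rels :: "nat \<Rightarrow> (nat \<Rightarrow> nat \<Rightarrow> enat) \<Rightarrow> (nat word \<times> nat word) set" where
  "coxeter_rels n m =
     {(concat (replicate k [(i, True), (j, True)]), []) | i j k. i < n \<and> j < n \<and> m i j = enat k}"

definition coxeter_system :: "('g, 'b) monoid_scheme \<Rightarrow> nat \<Rightarrow> (nat \<Rightarrow> 'g) \<Rightarrow> (nat \<Rightarrow> nat \<Rightarrow> enat) \<Rightarrow> bool" where
  "coxeter_system W n s m \<longleftrightarrow> group W \<and> coxeter_matrix n m \<and>
     (\<exists>\<phi> \<in> iso (pres_group {..<n} (coxeter_rels n m)) W.
        \<forall>i<n. \<phi> (pclass {..<n} (coxeter_rels n m) [(i, True)]) = s i)"

definition alt_word :: "nat \<Rightarrow> nat \<Rightarrow> nat \<Rightarrow> nat word" where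
  "alt_word a b k = map (\<lambda>l. (if even l then a else b, True)) [0..<k]"

definition artin_rels :: "nat \<Rightarrow> (nat \<Rightarrow> nat \<Rightarrow> enat) \<Rightarrow> (nat word \<times> nat word) set" where
  "artin_rels n m =
     {(alt_word i j k, alt_word j i k) | i j k. i < j \<and> j < n \<and> m i j = enat k}"

definition artin_group :: "nat \<Rightarrow> (nat \<Rightarrow> nat \<Rightarrow> enat) \<Rightarrow> (nat word set) monoid" where
  "artin_group n m = pres_group {..<n} (artin_rels n m)"

definition artin_gen :: "nat \<Rightarrow> (nat \<Rightarrow> nat \<Rightarrow> enat) \<Rightarrow> nat \<Rightarrow> nat word set" where
  "artin_gen n m i = pclass {..<n} (artin_rels n m) [(i, True)]"

definition braid_rels :: "nat \<Rightarrow> (nat word \<times> nat word) set" where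
  "braid_rels k =
     {([(i, True), (i + 1, True), (i, True)], [(i + 1, True), (i, True), (i + 1, True)]) | i.
        1 \<le> i \<and> i + 1 < k}
   \<union> {([(i, True), (j, True)], [(j, True), (i, True)]) | i j.
        1 \<le> i \<and> i + 2 \<le> j \<and> j < k}"

definition braid_group :: "nat \<Rightarrow> (nat word set) monoid" where
  "braid_group k = pres_group {1..<k} (braid_rels k)"

text \<open>Action of sigma_i^{+-1} on a tuple (list, positions 0-indexed, so g_i is at i-1).\<close>
fun hurwitz_gen :: "('g, 'b) monoid_scheme \<Rightarrow> nat \<times> bool \<Rightarrow> 'g list \<Rightarrow> 'g list" where
  "hurwitz_gen G (i, True) t =
     t[i - 1 := t ! (i - 1) \<otimes>\<^bsub>G\<^esub> t ! i \<otimes>\<^bsub>G\<^esub> inv\<^bsub>G\<^esub> (t ! (i - 1)), i := t ! (i - 1)]"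
| "hurwitz_gen G (i, False) t =
     t[i - 1 := t ! i, i := inv\<^bsub>G\<^esub> (t ! i) \<otimes>\<^bsub>G\<^esub> t ! (i - 1) \<otimes>\<^bsub>G\<^esub> t ! i]"

fun hurwitz :: "('g, 'b) monoid_scheme \<Rightarrow> nat word \<Rightarrow> 'g list \<Rightarrow> 'g list" where
  "hurwitz G [] t = t"
| "hurwitz G (x # w) t = hurwitz_gen G x (hurwitz G w t)"

definition hurwitz_stab :: "('g, 'b) monoid_scheme \<Rightarrow> nat \<Rightarrow> 'g list \<Rightarrow> nat word set set" where
  "hurwitz_stab G k t = {\<beta> \<in> carrier (braid_group k). \<forall>w\<in>\<beta>. hurwitz G w t = t}"

definition word_prod :: "('g, 'b) monoid_scheme \<Rightarrow> 'g list \<Rightarrow> 'g" where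
  "word_prod G xs = foldr (\<lambda>x y. x \<otimes>\<^bsub>G\<^esub> y) xs \<one>\<^bsub>G\<^esub>"

definition reps :: "('g, 'b) monoid_scheme \<Rightarrow> 'g set \<Rightarrow> 'g \<Rightarrow> nat \<Rightarrow> 'g list set" where
  "reps G Xs a k = {xs. length xs = k \<and> set xs \<subseteq> Xs \<union> (\<lambda>x. inv\<^bsub>G\<^esub> x) ` Xs \<and> word_prod G xs = a}"

definition wlen :: "('g, 'b) monoid_scheme \<Rightarrow> 'g set \<Rightarrow> 'g \<Rightarrow> nat" where
  "wlen G Xs a = (LEAST k. reps G Xs a k \<noteq> {})"

definition Red :: "('g, 'b) monoid_scheme \<Rightarrow> 'g set \<Rightarrow> 'g \<Rightarrow> 'g list set" where
  "Red G Xs a = reps G Xs a (wlen G Xs a)"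

definition interval1 :: "('g, 'b) monoid_scheme \<Rightarrow> 'g set \<Rightarrow> 'g \<Rightarrow> 'g set" where
  "interval1 G Xs b = {a \<in> carrier G.
     wlen G Xs a + wlen G Xs (inv\<^bsub>G\<^esub> a \<otimes>\<^bsub>G\<^esub> b) = wlen G Xs b}"

definition reflections :: "('g, 'b) monoid_scheme \<Rightarrow> nat \<Rightarrow> (nat \<Rightarrow> 'g) \<Rightarrow> 'g set" where
  "reflections W n s = {g \<otimes>\<^bsub>W\<^esub> s i \<otimes>\<^bsub>W\<^esub> inv\<^bsub>W\<^esub> g | g i. g \<in> carrier W \<and> i < n}"

definition well_stabilized :: "('g, 'b) monoid_scheme \<Rightarrow> nat \<Rightarrow> (nat \<Rightarrow> 'g) \<Rightarrow> (nat \<Rightarrow> nat \<Rightarrow> enat) \<Rightarrow> bool" where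
  "well_stabilized W n s m \<longleftrightarrow>
     hurwitz_stab W n (map s [0..<n]) =
     hurwitz_stab (artin_group n m) n (map (artin_gen n m) [0..<n])"

definition pan_transitive :: "('g, 'b) monoid_scheme \<Rightarrow> 'g set \<Rightarrow> 'g \<Rightarrow> bool" where
  "pan_transitive W T h \<longleftrightarrow>
     (\<forall>a \<in> interval1 W T h. \<forall>u \<in> Red W T a. \<forall>v \<in> Red W T a.
        \<exists>\<beta> \<in> carrier (braid_group (wlen W T a)). \<exists>w\<in>\<beta>. hurwitz W w u = v)"

definition dual_artin_rels :: "('g, 'b) monoid_scheme \<Rightarrow> 'g set \<Rightarrow> 'g \<Rightarrow> ('g word \<times> 'g word) set" where
  "dual_artin_rels W T h =
     {(map (\<lambda>t. (t, True)) u, map (\<lambda>t. (t, True)) v) | a u v.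
        a \<in> interval1 W T h \<and> u \<in> Red W T a \<and> v \<in> Red W T a}"

definition dual_artin_group :: "('g, 'b) monoid_scheme \<Rightarrow> 'g set \<Rightarrow> 'g \<Rightarrow> ('g word set) monoid" where
  "dual_artin_group W T h = pres_group (T \<inter> interval1 W T h) (dual_artin_rels W T h)"

end

theory Submission
  imports Defs Complex_Main "HOL-Library.Function_Algebras"
begin

text \<open>The map from the Artin group to the dual Artin group sends the generator of \<open>s\<^sub>i\<close> to the one of the reflection
  \<open>s\<^sub>i\<close>; the braid relations hold because consecutive reflections of a dihedral subgroup have a constant product
  below \<open>h\<close>. Both groups see the Hurwitz action on reduced reflection factorizations of \<open>h\<close>, so transitivity makes
  the map surjective. Conversely, since \<open>H\<close> equals its counterpart in the Artin group, each reduced factorization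
  \<open>\<beta> (s\<^sub>1, \<dots>, s\<^sub>n)\<close> of \<open>h\<close> has a well-defined lift, obtained by applying \<open>\<beta>\<close> to the Artin generators.
  Transitivity on the factorizations of the elements below \<open>h\<close> shows that the lift of a single reflection is
  independent of the factorization and that lifts satisfy the dual relations, which gives a left inverse.

  All this needs that \<open>s\<^sub>1 \<cdots> s\<^sub>n\<close> has reflection length \<open>n\<close>. Let \<open>W\<close> act on \<open>\<real>\<^sup>n\<close> by affine reflections
  parametrized by a translation vector \<open>z\<close>. A product of \<open>k\<close> reflections displaces every point, for every \<open>z\<close>,
  within a fixed space of dimension at most \<open>k\<close>, while \<open>s\<^sub>1 \<cdots> s\<^sub>n\<close> moves the origin to any prescribed point
  for a suitable \<open>z\<close>.\<close>

section \<open>Group presentations\<close>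

definition word_ev :: "('g, 'b) monoid_scheme \<Rightarrow> ('a \<Rightarrow> 'g) \<Rightarrow> 'a word \<Rightarrow> 'g" where
  "word_ev G f w = foldr (\<lambda>(x, b) y. (if b then f x else inv\<^bsub>G\<^esub> (f x)) \<otimes>\<^bsub>G\<^esub> y) w \<one>\<^bsub>G\<^esub>"

lemma word_ev_Nil [simp]: "word_ev G f [] = \<one>\<^bsub>G\<^esub>"
  by (simp add: word_ev_def)

lemma word_ev_Cons [simp]:
  "word_ev G f ((x, b) # w) = (if b then f x else inv\<^bsub>G\<^esub> (f x)) \<otimes>\<^bsub>G\<^esub> word_ev G f w"
  by (simp add: word_ev_def)

lemma word_prod_Nil [simp]: "word_prod G [] = \<one>\<^bsub>G\<^esub>"
  by (simp add: word_prod_def)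

lemma word_prod_Cons [simp]: "word_prod G (x # xs) = x \<otimes>\<^bsub>G\<^esub> word_prod G xs"
  by (simp add: word_prod_def)

lemma word_ev_positive:
  "word_ev G f (map (\<lambda>t. (t, True)) u) = word_prod G (map f u)"
  by (induction u) auto

lemma word_ev_cong:
  "w \<in> lists (Xs \<times> UNIV) \<Longrightarrow> (\<And>x. x \<in> Xs \<Longrightarrow> f x = g x) \<Longrightarrow> word_ev G f w = word_ev G g w"
  by (induction w) auto

context group
begin

lemma mult_inv_cancel:
  assumes "x \<in> carrier G" "y \<in> carrier G"
  shows "x \<otimes> (inv x \<otimes> y) = y" "inv x \<otimes> (x \<otimes> y) = y"
  using assms by (simp_all flip: m_assoc)

lemmas group_normalize = m_assoc inv_mult_group mult_inv_cancel

lemma word_ev_closed [simp]: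
  "f \<in> Xs \<rightarrow> carrier G \<Longrightarrow> w \<in> lists (Xs \<times> UNIV) \<Longrightarrow> word_ev G f w \<in> carrier G"
  by (induction w) (auto simp: Pi_iff)

lemma word_ev_append:
  "f \<in> Xs \<rightarrow> carrier G \<Longrightarrow> u \<in> lists (Xs \<times> UNIV) \<Longrightarrow> v \<in> lists (Xs \<times> UNIV) \<Longrightarrow>
   word_ev G f (u @ v) = word_ev G f u \<otimes> word_ev G f v"
proof (induction u)
  case (Cons a u)
  obtain x b where a: "a = (x, b)" by fastforce
  have "x \<in> Xs" "u \<in> lists (Xs \<times> UNIV)" using Cons.prems a by auto
  then show ?case
    using Cons a word_ev_closed[of f Xs u] word_ev_closed[of f Xs v] by (auto simp: m_assoc Pi_iff)
qed simp

lemma word_prod_closed [simp]: "set xs \<subseteq> carrier G \<Longrightarrow> word_prod G xs \<in> carrier G"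
  by (induction xs) auto

lemma word_prod_append:
  "set xs \<subseteq> carrier G \<Longrightarrow> set ys \<subseteq> carrier G \<Longrightarrow>
   word_prod G (xs @ ys) = word_prod G xs \<otimes> word_prod G ys"
  by (induction xs) (auto simp: m_assoc)

text \<open>\<open>pres_eq\<close> does not restrict the letters of intermediate words, so induction
  on a derivation needs a group value for every letter of the type.\<close>

lemma word_ev_pres_eq_total:
  assumes f: "\<And>x. f x \<in> carrier G"
    and R: "\<And>l r. (l, r) \<in> R \<Longrightarrow> word_ev G f l = word_ev G f r"
    and "pres_eq R u v"
  shows "word_ev G f u = word_ev G f v"
proof -
  have [simp]: "f \<in> UNIV \<rightarrow> carrier G" using f by auto
  have app: "word_ev G f (u @ v) = word_ev G f u \<otimes> word_ev G f v" for u v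
    by (rule word_ev_append[where Xs = UNIV]) auto
  have [simp]: "word_ev G f w \<in> carrier G" for w
    by (rule word_ev_closed[where Xs = UNIV]) auto
  show ?thesis
    using assms(3)
  proof induction
    case (pe_cancel u x b v)
    have "word_ev G f [(x, b), (x, \<not> b)] = \<one>" using f by simp
    then show ?case by (simp only: app) simp
  qed (auto simp: app R)
qed

lemma word_ev_pres_eq:
  assumes f: "f \<in> Xs \<rightarrow> carrier G"
    and R: "R \<subseteq> lists (Xs \<times> UNIV) \<times> lists (Xs \<times> UNIV)"
    and rel: "\<And>l r. (l, r) \<in> R \<Longrightarrow> word_ev G f l = word_ev G f r"
    and u: "u \<in> lists (Xs \<times> UNIV)" and v: "v \<in> lists (Xs \<times> UNIV)"
    and eq: "pres_eq R u v"
  shows "word_ev G f u = word_ev G f v"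
proof -
  \<comment> \<open>A derivation between words over Xs may pass through foreign letters; send those to the unit.\<close>
  define g where "g x = (if x \<in> Xs then f x else \<one>)" for x
  have fg: "word_ev G g w = word_ev G f w" if "w \<in> lists (Xs \<times> UNIV)" for w
    using that by (rule word_ev_cong) (simp add: g_def)
  have "word_ev G g u = word_ev G g v"
  proof (rule word_ev_pres_eq_total[OF _ _ eq])
    show "g x \<in> carrier G" for x using f by (auto simp: g_def)
    show "word_ev G g l = word_ev G g r" if "(l, r) \<in> R" for l r
    proof -
      have "l \<in> lists (Xs \<times> UNIV)" "r \<in> lists (Xs \<times> UNIV)" using R that by blast+
      then show ?thesis using rel[OF that] by (simp only: fg)
    qed
  qed
  then show ?thesis by (simp add: fg u v)
qed

end

section \<open>Formal inverses and the universal property of a presentation\<close>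

definition winv :: "'a word \<Rightarrow> 'a word" where
  "winv w = rev (map (\<lambda>(x, b). (x, \<not> b)) w)"

lemma winv_Nil [simp]: "winv [] = []"
  by (simp add: winv_def)

lemma winv_Cons [simp]: "winv ((x, b) # w) = winv w @ [(x, \<not> b)]"
  by (simp add: winv_def)

lemma winv_lists [simp]: "w \<in> lists (Xs \<times> UNIV) \<Longrightarrow> winv w \<in> lists (Xs \<times> UNIV)"
  by (induction w) auto

lemma pres_eq_context: "pres_eq R u v \<Longrightarrow> pres_eq R (a @ u @ b) (a @ v @ b)"
proof (induction rule: pres_eq.induct)
  case (pe_cancel u x c v)
  show ?case using pres_eq.pe_cancel[of R "a @ u" x c "v @ b"] by simp
next
  case (pe_rel l r u v)
  show ?case using pres_eq.pe_rel[OF pe_rel, of "a @ u" "v @ b"] by simp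
qed (blast intro: pres_eq.intros)+

lemma pres_eq_append:
  assumes "pres_eq R u u'" "pres_eq R v v'"
  shows "pres_eq R (u @ v) (u' @ v')"
  using pres_eq_context[OF assms(1), of "[]" v] pres_eq_context[OF assms(2), of u' "[]"]
  by (auto intro: pe_trans)

lemma pres_eq_winv_right: "pres_eq R (w @ winv w) []"
proof (induction w)
  case (Cons a w)
  obtain x b where [simp]: "a = (x, b)" by fastforce
  have "pres_eq R ([(x, b)] @ (w @ winv w) @ [(x, \<not> b)]) ([(x, b)] @ [] @ [(x, \<not> b)])"
    by (rule pres_eq_context[OF Cons])
  moreover have "pres_eq R [(x, b), (x, \<not> b)] []"
    using pe_cancel[of R "[]" x b "[]"] by simp
  ultimately show ?case by (auto intro: pe_trans)
qed (simp add: pe_refl)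

lemma winv_winv [simp]: "winv (winv w) = w"
  by (induction w) (auto simp: winv_def rev_map)

lemma pres_eq_winv_left: "pres_eq R (winv w @ w) []"
  using pres_eq_winv_right[of R "winv w"] by simp

lemma pclass_eq_iff:
  assumes "u \<in> lists (Xs \<times> UNIV)" "v \<in> lists (Xs \<times> UNIV)"
  shows "pclass Xs R u = pclass Xs R v \<longleftrightarrow> pres_eq R u v"
proof
  assume "pclass Xs R u = pclass Xs R v"
  moreover have "v \<in> pclass Xs R v" using assms by (simp add: pclass_def pe_refl)
  ultimately show "pres_eq R u v" by (auto simp: pclass_def)
qed (auto simp: pclass_def intro: pe_trans pe_sym)

lemma pclass_self: "w \<in> lists (Xs \<times> UNIV) \<Longrightarrow> w \<in> pclass Xs R w"
  by (simp add: pclass_def pe_refl)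

lemma carrier_pres_group: "carrier (pres_group Xs R) = {pclass Xs R w | w. w \<in> lists (Xs \<times> UNIV)}"
  by (simp add: pres_group_def)

lemma pclass_carrier: "w \<in> lists (Xs \<times> UNIV) \<Longrightarrow> pclass Xs R w \<in> carrier (pres_group Xs R)"
  by (auto simp: carrier_pres_group)

lemma one_pres_group: "\<one>\<^bsub>pres_group Xs R\<^esub> = pclass Xs R []"
  by (simp add: pres_group_def)

text \<open>\<open>pres_eq\<close> is a congruence for concatenation, so the product, defined
  through all members of both classes, can be computed from any two representatives.\<close>

lemma mult_pres_group:
  assumes "u \<in> lists (Xs \<times> UNIV)" "v \<in> lists (Xs \<times> UNIV)"
  shows "pclass Xs R u \<otimes>\<^bsub>pres_group Xs R\<^esub> pclass Xs R v = pclass Xs R (u @ v)"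
proof -
  have "(\<exists>u'\<in>pclass Xs R u. \<exists>v'\<in>pclass Xs R v. pres_eq R (u' @ v') w) \<longleftrightarrow> pres_eq R (u @ v) w" for w
  proof
    assume "pres_eq R (u @ v) w"
    with assms pclass_self show "\<exists>u'\<in>pclass Xs R u. \<exists>v'\<in>pclass Xs R v. pres_eq R (u' @ v') w"
      by blast
  next
    assume "\<exists>u'\<in>pclass Xs R u. \<exists>v'\<in>pclass Xs R v. pres_eq R (u' @ v') w"
    then obtain u' v' where "pres_eq R u u'" "pres_eq R v v'" and w: "pres_eq R (u' @ v') w"
      unfolding pclass_def by blast
    then show "pres_eq R (u @ v) w"
      using pres_eq_append pe_trans[OF _ w] by metis
  qed
  then show ?thesis by (simp add: pres_group_def pclass_def[of _ _ "u @ v"])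
qed

lemma group_pres_group [simp]: "group (pres_group Xs R)"
proof (rule groupI)
  fix x y z
  assume "x \<in> carrier (pres_group Xs R)" "y \<in> carrier (pres_group Xs R)"
    "z \<in> carrier (pres_group Xs R)"
  then obtain u v w where "x = pclass Xs R u" "y = pclass Xs R v" "z = pclass Xs R w"
      "u \<in> lists (Xs \<times> UNIV)" "v \<in> lists (Xs \<times> UNIV)" "w \<in> lists (Xs \<times> UNIV)"
    unfolding carrier_pres_group by blast
  then show "x \<otimes>\<^bsub>pres_group Xs R\<^esub> y \<otimes>\<^bsub>pres_group Xs R\<^esub> z =
      x \<otimes>\<^bsub>pres_group Xs R\<^esub> (y \<otimes>\<^bsub>pres_group Xs R\<^esub> z)"
    by (simp add: mult_pres_group)
next
  fix x y
  assume "x \<in> carrier (pres_group Xs R)" "y \<in> carrier (pres_group Xs R)"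
  then obtain u v where "x = pclass Xs R u" "y = pclass Xs R v"
      "u \<in> lists (Xs \<times> UNIV)" "v \<in> lists (Xs \<times> UNIV)"
    unfolding carrier_pres_group by blast
  then show "x \<otimes>\<^bsub>pres_group Xs R\<^esub> y \<in> carrier (pres_group Xs R)"
    by (simp add: mult_pres_group pclass_carrier)
next
  show "\<one>\<^bsub>pres_group Xs R\<^esub> \<in> carrier (pres_group Xs R)"
    by (simp add: one_pres_group pclass_carrier)
next
  fix x assume "x \<in> carrier (pres_group Xs R)"
  then obtain w where w: "x = pclass Xs R w" "w \<in> lists (Xs \<times> UNIV)"
    unfolding carrier_pres_group by blast
  then show "\<one>\<^bsub>pres_group Xs R\<^esub> \<otimes>\<^bsub>pres_group Xs R\<^esub> x = x"
    by (simp add: one_pres_group mult_pres_group)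
  have "pclass Xs R (winv w) \<otimes>\<^bsub>pres_group Xs R\<^esub> x = \<one>\<^bsub>pres_group Xs R\<^esub>"
    using w by (simp add: one_pres_group mult_pres_group pclass_eq_iff pres_eq_winv_left)
  moreover have "pclass Xs R (winv w) \<in> carrier (pres_group Xs R)"
    using w by (intro pclass_carrier winv_lists)
  ultimately show "\<exists>y\<in>carrier (pres_group Xs R). y \<otimes>\<^bsub>pres_group Xs R\<^esub> x = \<one>\<^bsub>pres_group Xs R\<^esub>"
    by blast
qed

text \<open>Uniqueness half of the universal property: the class of an inverse letter is the inverse
  of the class of the letter, so the values on generators determine everything. Taking the identity
  for \<open>\<theta>\<close> writes each class as a product of generators.\<close>

lemma hom_pclass:
  assumes G: "group G" and \<theta>: "\<theta> \<in> hom (pres_group Xs R) G" and w: "w \<in> lists (Xs \<times> UNIV)"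
  shows "\<theta> (pclass Xs R w) = word_ev G (\<lambda>x. \<theta> (pclass Xs R [(x, True)])) w"
  using w
proof (induction w)
  case Nil
  show ?case using hom_one[OF \<theta> group_pres_group G] by (simp add: one_pres_group)
next
  case (Cons a w)
  interpret P: group "pres_group Xs R" by simp
  interpret G: group G by fact
  interpret h: group_hom "pres_group Xs R" G \<theta>
    using \<theta> by unfold_locales
  obtain x b where a: "a = (x, b)" and x: "x \<in> Xs" using Cons by force
  have car: "pclass Xs R [(x, c)] \<in> carrier (pres_group Xs R)" for c
    using x by (intro pclass_carrier) auto
  have "pclass Xs R [(x, False)] \<otimes>\<^bsub>pres_group Xs R\<^esub> pclass Xs R [(x, True)] = \<one>\<^bsub>pres_group Xs R\<^esub>"
    using x pe_cancel[of R "[]" x False "[]"]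
    by (simp add: mult_pres_group one_pres_group pclass_eq_iff)
  then have "pclass Xs R [(x, False)] = inv\<^bsub>pres_group Xs R\<^esub> pclass Xs R [(x, True)]"
    using car P.inv_equality by metis
  then have 1: "\<theta> (pclass Xs R [(x, b)]) =
      (if b then \<theta> (pclass Xs R [(x, True)]) else inv\<^bsub>G\<^esub> (\<theta> (pclass Xs R [(x, True)])))"
    using car by simp
  have w: "w \<in> lists (Xs \<times> UNIV)" using Cons by auto
  have "pclass Xs R (a # w) = pclass Xs R [(x, b)] \<otimes>\<^bsub>pres_group Xs R\<^esub> pclass Xs R w"
    using x w a by (subst mult_pres_group) auto
  then have "\<theta> (pclass Xs R (a # w)) = \<theta> (pclass Xs R [(x, b)]) \<otimes>\<^bsub>G\<^esub> \<theta> (pclass Xs R w)"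
    using car pclass_carrier[OF w] by simp
  then show ?case using Cons.IH 1 a w by simp
qed

lemma pclass_eq_word_ev:
  assumes "w \<in> lists (Xs \<times> UNIV)"
  shows "pclass Xs R w = word_ev (pres_group Xs R) (\<lambda>x. pclass Xs R [(x, True)]) w"
  using hom_pclass[of "pres_group Xs R" "\<lambda>x. x"] assms by (simp add: hom_def Pi_iff)

lemma pres_group_lift:
  assumes G: "group G" and f: "f \<in> Xs \<rightarrow> carrier G"
    and R: "R \<subseteq> lists (Xs \<times> UNIV) \<times> lists (Xs \<times> UNIV)"
    and rel: "\<And>l r. (l, r) \<in> R \<Longrightarrow> word_ev G f l = word_ev G f r"
  obtains \<theta> where "\<theta> \<in> hom (pres_group Xs R) G"
    and "\<And>w. w \<in> lists (Xs \<times> UNIV) \<Longrightarrow> \<theta> (pclass Xs R w) = word_ev G f w"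
proof
  interpret G: group G by fact
  \<comment> \<open>The map evaluates an arbitrarily chosen member of the class; the choice is
    harmless because evaluation respects derivations.\<close>
  let ?\<theta> = "\<lambda>A. word_ev G f (SOME w. w \<in> A)"
  show *: "?\<theta> (pclass Xs R w) = word_ev G f w" if w: "w \<in> lists (Xs \<times> UNIV)" for w
  proof -
    have "(SOME v. v \<in> pclass Xs R w) \<in> pclass Xs R w"
      using pclass_self[OF w] by (rule someI)
    then show ?thesis
      using G.word_ev_pres_eq[OF f R rel] w by (auto simp: pclass_def intro: pe_sym)
  qed
  show "?\<theta> \<in> hom (pres_group Xs R) G"
  proof (rule homI)
    fix x y
    assume "x \<in> carrier (pres_group Xs R)" "y \<in> carrier (pres_group Xs R)"
    then obtain u v where xy: "x = pclass Xs R u" "y = pclass Xs R v"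
      and u: "u \<in> lists (Xs \<times> UNIV)" and v: "v \<in> lists (Xs \<times> UNIV)"
      unfolding carrier_pres_group by blast
    show "?\<theta> x \<in> carrier G"
      unfolding xy *[OF u] by (rule G.word_ev_closed[OF f u])
    have uv: "u @ v \<in> lists (Xs \<times> UNIV)" using u v by auto
    show "?\<theta> (x \<otimes>\<^bsub>pres_group Xs R\<^esub> y) = ?\<theta> x \<otimes>\<^bsub>G\<^esub> ?\<theta> y"
      unfolding xy mult_pres_group[OF u v] *[OF u] *[OF v] *[OF uv] by (rule G.word_ev_append[OF f u v])
  qed
qed

section \<open>Hurwitz action\<close>

text \<open>Exposing the two affected entries by splitting the list removes all index arithmetic;
  generator indices start at 1, hence the \<open>Suc\<close>. This form replaces the defining
  equations as the simplification rule.\<close>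

lemma hurwitz_gen_split:
  "hurwitz_gen G (Suc (length a), True) (a @ x # y # b) = a @ (x \<otimes>\<^bsub>G\<^esub> y \<otimes>\<^bsub>G\<^esub> inv\<^bsub>G\<^esub> x) # x # b"
  "hurwitz_gen G (Suc (length a), False) (a @ x # y # b) = a @ y # (inv\<^bsub>G\<^esub> y \<otimes>\<^bsub>G\<^esub> x \<otimes>\<^bsub>G\<^esub> y) # b"
  by (simp_all add: nth_append list_update_append)

lemma adjacent_split:
  assumes "i \<in> {1..<length t}"
  obtains a x y b where "t = a @ x # y # b" "i = Suc (length a)"
proof
  show "t = take (i - 1) t @ t ! (i - 1) # t ! i # drop (Suc i) t"
    using assms id_take_nth_drop[of "i - 1" t] Cons_nth_drop_Suc[of i t] by auto
  show "i = Suc (length (take (i - 1) t))" using assms by auto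
qed

lemma hurwitz_gen_cases:
  assumes "p \<in> {1..<length t} \<times> UNIV"
  obtains a x y b where "t = a @ x # y # b" "p = (Suc (length a), True)"
  | a x y b where "t = a @ x # y # b" "p = (Suc (length a), False)"
proof -
  obtain i c where p: "p = (i, c)" by fastforce
  then have "i \<in> {1..<length t}" using assms by auto
  then obtain a x y b where "t = a @ x # y # b" "i = Suc (length a)" by (rule adjacent_split)
  then show thesis using that p by (cases c) auto
qed

lemma length_hurwitz_gen [simp]: "length (hurwitz_gen G p t) = length t"
  by (cases p; cases "snd p") auto

declare hurwitz_gen.simps [simp del] hurwitz_gen_split [simp]

lemma length_hurwitz [simp]: "length (hurwitz G w t) = length t"
  by (induction w) auto

lemma hurwitz_word_append: "hurwitz G (u @ v) t = hurwitz G u (hurwitz G v t)"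
  by (induction u) auto

text \<open>A braid on the first strands leaves the tail alone. This allows a factorization of an
  element below \<open>h\<close> to be changed inside a factorization of \<open>h\<close>.\<close>

lemma hurwitz_prefix:
  "w \<in> lists ({1..<length t} \<times> UNIV) \<Longrightarrow> hurwitz G w (t @ t') = hurwitz G w t @ t'"
proof (induction w)
  case (Cons p w)
  let ?h = "hurwitz G w t"
  have "p \<in> {1..<length ?h} \<times> UNIV" using Cons.prems by auto
  then have "hurwitz_gen G p (?h @ t') = hurwitz_gen G p ?h @ t'"
    by (cases rule: hurwitz_gen_cases) (simp_all)
  then show ?case using Cons by simp
qed simp

definition shift_word :: "nat word \<Rightarrow> nat word" where
  "shift_word w = map (\<lambda>(i, b). (Suc i, b)) w"

lemma shift_word_lists:
  "w \<in> lists ({1..<k} \<times> UNIV) \<Longrightarrow> shift_word w \<in> lists ({1..<Suc k} \<times> UNIV)"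
  by (induction w) (auto simp: shift_word_def)

lemma hurwitz_shift:
  "w \<in> lists ({1..<length t} \<times> UNIV) \<Longrightarrow> hurwitz G (shift_word w) (x # t) = x # hurwitz G w t"
proof (induction w)
  case (Cons p w)
  let ?h = "hurwitz G w t"
  have "p \<in> {1..<length ?h} \<times> UNIV" using Cons.prems by auto
  then have "hurwitz_gen G (Suc (fst p), snd p) (x # ?h) = x # hurwitz_gen G p ?h"
  proof (cases rule: hurwitz_gen_cases)
    case (1 a y z b)
    then show ?thesis using hurwitz_gen_split(1)[of G "x # a" y z b] hurwitz_gen_split(1)[of G a y z b]
      by simp
  next
    case (2 a y z b)
    then show ?thesis using hurwitz_gen_split(2)[of G "x # a" y z b] hurwitz_gen_split(2)[of G a y z b]
      by simp
  qed
  then show ?case using Cons by (cases p) (simp add: shift_word_def)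
qed (simp add: shift_word_def)

lemma hurwitz_closed:
  assumes "\<And>x y. x \<in> T \<Longrightarrow> y \<in> T \<Longrightarrow> x \<otimes>\<^bsub>G\<^esub> y \<otimes>\<^bsub>G\<^esub> inv\<^bsub>G\<^esub> x \<in> T \<and> inv\<^bsub>G\<^esub> x \<otimes>\<^bsub>G\<^esub> y \<otimes>\<^bsub>G\<^esub> x \<in> T"
    and "set t \<subseteq> T"
  shows "w \<in> lists ({1..<length t} \<times> UNIV) \<Longrightarrow> set (hurwitz G w t) \<subseteq> T"
proof (induction w)
  case (Cons p w)
  let ?h = "hurwitz G w t"
  have "p \<in> {1..<length ?h} \<times> UNIV" "set ?h \<subseteq> T" using Cons by auto
  then have "set (hurwitz_gen G p ?h) \<subseteq> T"
    by (cases rule: hurwitz_gen_cases) (simp_all add: assms)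
  then show ?case by simp
qed (simp add: assms)

lemma (in group) hurwitz_carrier:
  "set t \<subseteq> carrier G \<Longrightarrow> w \<in> lists ({1..<length t} \<times> UNIV) \<Longrightarrow> set (hurwitz G w t) \<subseteq> carrier G"
  by (rule hurwitz_closed) auto

lemma (in group) hurwitz_word_prod:
  assumes "set t \<subseteq> carrier G"
  shows "w \<in> lists ({1..<length t} \<times> UNIV) \<Longrightarrow> word_prod G (hurwitz G w t) = word_prod G t"
proof (induction w)
  case (Cons p w)
  let ?h = "hurwitz G w t"
  have p: "p \<in> {1..<length ?h} \<times> UNIV" and h: "set ?h \<subseteq> carrier G"
    using Cons hurwitz_carrier[OF assms] by auto
  have 1: "x \<otimes> y \<otimes> inv x \<otimes> (x \<otimes> z) = x \<otimes> (y \<otimes> z)" "y \<otimes> (inv y \<otimes> x \<otimes> y \<otimes> z) = x \<otimes> (y \<otimes> z)"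
    if "x \<in> carrier G" "y \<in> carrier G" "z \<in> carrier G" for x y z
    using that by (simp_all add: group_normalize)
  have "word_prod G (hurwitz_gen G p ?h) = word_prod G ?h"
    using p by (cases rule: hurwitz_gen_cases)
      (use h in \<open>simp_all add: word_prod_append 1\<close>)
  then show ?case using Cons by simp
qed simp

lemma (in group) hurwitz_winv:
  assumes "set t \<subseteq> carrier G"
  shows "w \<in> lists ({1..<length t} \<times> UNIV) \<Longrightarrow> hurwitz G (winv w) (hurwitz G w t) = t"
proof (induction w)
  case (Cons p w)
  let ?h = "hurwitz G w t"
  have p: "p \<in> {1..<length ?h} \<times> UNIV" and h: "set ?h \<subseteq> carrier G"
    using Cons hurwitz_carrier[OF assms] by auto
  have 1: "inv x \<otimes> (x \<otimes> y \<otimes> inv x) \<otimes> x = y" "y \<otimes> (inv y \<otimes> x \<otimes> y) \<otimes> inv y = x"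
    if "x \<in> carrier G" "y \<in> carrier G" for x y
    using that by (simp_all add: group_normalize)
  have "hurwitz_gen G (fst p, \<not> snd p) (hurwitz_gen G p ?h) = ?h"
    using p by (cases rule: hurwitz_gen_cases)
      (use h in \<open>simp_all add: 1\<close>)
  then show ?case using Cons by (cases p) (simp add: hurwitz_word_append)
qed simp

text \<open>Hurwitz moves use only products and inverses, so homomorphisms commute with
  them.\<close>

lemma hurwitz_map_hom:
  assumes "group_hom G H f" "set t \<subseteq> carrier G"
  shows "w \<in> lists ({1..<length t} \<times> UNIV) \<Longrightarrow> map f (hurwitz G w t) = hurwitz H w (map f t)"
proof (induction w)
  case (Cons p w)
  interpret group_hom G H f by fact
  let ?h = "hurwitz G w t"
  have p: "p \<in> {1..<length ?h} \<times> UNIV" and h: "set ?h \<subseteq> carrier G"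
    using Cons G.hurwitz_carrier[OF assms(2)] by auto
  have "map f (hurwitz_gen G p ?h) = hurwitz_gen H p (map f ?h)"
    using p
  proof (cases rule: hurwitz_gen_cases)
    case (1 a x y b)
    then show ?thesis using h hurwitz_gen_split(1)[of H "map f a"]
      by (simp)
  next
    case (2 a x y b)
    then show ?thesis using h hurwitz_gen_split(2)[of H "map f a"]
      by (simp)
  qed
  then show ?case using Cons by simp
qed simp

text \<open>Derivations in the braid presentation may use letters that are not generators of the braid group, on which the
  Hurwitz formula is junk; these are deleted first.\<close>

lemma (in group) hurwitz_pres_eq_filter:
  assumes "pres_eq (braid_rels k) u v"
  shows "length t = k \<Longrightarrow> set t \<subseteq> carrier G \<Longrightarrow>
    hurwitz G (filter (\<lambda>p. fst p \<in> {1..<k}) u) t = hurwitz G (filter (\<lambda>p. fst p \<in> {1..<k}) v) t"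
  using assms
proof (induction arbitrary: t)
  case (pe_cancel u x b v)
  let ?v = "filter (\<lambda>p. fst p \<in> {1..<k}) v"
  have v: "?v \<in> lists ({1..<length t} \<times> UNIV)" using pe_cancel by force
  have "hurwitz G [(x, b), (x, \<not> b)] (hurwitz G ?v t) = hurwitz G ?v t" if "x \<in> {1..<k}"
    using hurwitz_winv[OF hurwitz_carrier[OF pe_cancel(2) v], of "[(x, \<not> b)]"] that pe_cancel by simp
  then show ?case by (simp add: hurwitz_word_append)
next
  case (pe_rel l r u v)
  let ?v = "filter (\<lambda>p. fst p \<in> {1..<k}) v"
  let ?t = "hurwitz G ?v t"
  have "?v \<in> lists ({1..<length t} \<times> UNIV)" using pe_rel by force
  then have t: "length ?t = k" "set ?t \<subseteq> carrier G"
    using hurwitz_carrier pe_rel by auto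
  have "filter (\<lambda>p. fst p \<in> {1..<k}) l = l \<and> filter (\<lambda>p. fst p \<in> {1..<k}) r = r
    \<and> hurwitz G l ?t = hurwitz G r ?t"
    using pe_rel(1) unfolding braid_rels_def
  proof (elim UnE CollectE exE conjE)
    fix i assume *: "(l, r) = ([(i, True), (i + 1, True), (i, True)], [(i + 1, True), (i, True), (i + 1, True)])"
      "1 \<le> i" "i + 1 < k"
    have "i \<in> {1..<length ?t}" using * t by simp
    then obtain a x y b' where 1: "?t = a @ x # y # b'" "i = Suc (length a)"
      by (rule adjacent_split)
    have "length a + 2 + length b' = k" using t unfolding 1(1) by simp
    then obtain z b where b: "b' = z # b" using * 1(2) by (cases b') auto
    note tt = 1(1)[unfolded b]
    have c: "x \<in> carrier G" "y \<in> carrier G" "z \<in> carrier G" using t unfolding tt by auto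
    note S = hurwitz_gen_split(1)[of G a] hurwitz_gen_split(1)[of G "a @ [u]" for u, simplified]
    \<comment> \<open>Both sides of the braid relation visibly give the same second and third entry.
      Agreement of the first entry says that conjugation by \<open>x\<close> is compatible with
      conjugating \<open>z\<close> by \<open>y\<close>.\<close>
    have "x \<otimes> y \<otimes> inv x \<otimes> (x \<otimes> z \<otimes> inv x) \<otimes> inv (x \<otimes> y \<otimes> inv x) = x \<otimes> (y \<otimes> z \<otimes> inv y) \<otimes> inv x"
      using c by (simp add: group_normalize)
    then have "hurwitz G l ?t = hurwitz G r ?t"
      using * 1(2) unfolding tt by (simp add: S)
    then show ?thesis using * by auto
  next
    fix i j assume *: "(l, r) = ([(i, True), (j, True)], [(j, True), (i, True)])" "1 \<le> i" "i + 2 \<le> j" "j < k"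
    have "i \<in> {1..<length ?t}" using * t by simp
    then obtain a x y b' where 1: "?t = a @ x # y # b'" "i = Suc (length a)"
      by (rule adjacent_split)
    have "length a + 2 + length b' = k" using t unfolding 1(1) by simp
    \<comment> \<open>The second generator acts entirely beyond the pair \<open>x\<close>,
      \<open>y\<close>; its position is recomputed relative to the remaining list.\<close>
    then have "j - length a - 2 \<in> {1..<length b'}" using *(3,4) 1(2) by auto
    then obtain a' z z' b where 2: "b' = a' @ z # z' # b" "j - length a - 2 = Suc (length a')"
      by (rule adjacent_split)
    have j: "j = Suc (length a + 2 + length a')" using 2(2) by simp
    note tt = 1(1)[unfolded 2(1)]
    note S = hurwitz_gen_split(1)[of G a] hurwitz_gen_split(1)[of G "a @ u # v # a'" for u v, simplified]
    have "hurwitz G l ?t = hurwitz G r ?t"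
      using * 1(2) j unfolding tt by (simp add: S)
    then show ?thesis using * by auto
  qed
  then show ?case by (simp add: hurwitz_word_append)
qed auto

lemma (in group) hurwitz_pres_eq:
  assumes "pres_eq (braid_rels (length t)) u v" "set t \<subseteq> carrier G"
    "u \<in> lists ({1..<length t} \<times> UNIV)" "v \<in> lists ({1..<length t} \<times> UNIV)"
  shows "hurwitz G u t = hurwitz G v t"
proof -
  have "filter (\<lambda>p. fst p \<in> {1..<length t}) w = w" if "w \<in> lists ({1..<length t} \<times> UNIV)"
    for w :: "nat word"
    using that by (auto simp: filter_id_conv)
  then show ?thesis using hurwitz_pres_eq_filter[OF assms(1) refl assms(2)] assms(3,4) by metis
qed

text \<open>\<open>hurwitz_stab\<close> tests every word of a class, but equivalent braid words act
  alike, so one representative decides membership.\<close>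

lemma (in group) pclass_mem_hurwitz_stab:
  assumes "length t = k" "set t \<subseteq> carrier G" "w \<in> lists ({1..<k} \<times> UNIV)"
  shows "pclass {1..<k} (braid_rels k) w \<in> hurwitz_stab G k t \<longleftrightarrow> hurwitz G w t = t"
proof
  assume "pclass {1..<k} (braid_rels k) w \<in> hurwitz_stab G k t"
  then show "hurwitz G w t = t"
    using pclass_self[OF assms(3)] by (simp add: hurwitz_stab_def)
next
  assume fixed: "hurwitz G w t = t"
  have "hurwitz G v t = t" if "v \<in> pclass {1..<k} (braid_rels k) w" for v
  proof -
    have "v \<in> lists ({1..<k} \<times> UNIV)" "pres_eq (braid_rels k) w v"
      using that unfolding pclass_def by blast+
    then show ?thesis using hurwitz_pres_eq[of t w v] fixed assms by metis
  qed
  then show "pclass {1..<k} (braid_rels k) w \<in> hurwitz_stab G k t"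
    unfolding hurwitz_stab_def braid_group_def using pclass_carrier[OF assms(3)] by blast
qed

section \<open>An affine action of a Coxeter group\<close>

text \<open>The bilinear form of the geometric representation, scaled so that simple roots have
  square length 2; an infinite bond gets the limiting value -2. The diagonal is set without
  consulting \<open>m\<close>, so it equals 2 at every index.\<close>

definition cox_form :: "(nat \<Rightarrow> nat \<Rightarrow> enat) \<Rightarrow> nat \<Rightarrow> nat \<Rightarrow> real" where
  "cox_form m i j = (if i = j then 2 else case m i j of enat k \<Rightarrow> - 2 * cos (pi / k) | \<infinity> \<Rightarrow> - 2)"

text \<open>In simple root coordinates and for \<open>A = cox_form m\<close>, this is the reflection
  in the root with index \<open>i\<close>, followed by a translation by \<open>- z i\<close> along
  that root. Foreign letters act as the identity because derivations may contain them.\<close>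

definition aff_refl :: "nat \<Rightarrow> (nat \<Rightarrow> nat \<Rightarrow> real) \<Rightarrow> (nat \<Rightarrow> real) \<Rightarrow> nat \<Rightarrow> (nat \<Rightarrow> real) \<Rightarrow> nat \<Rightarrow> real" where
  "aff_refl n A z i y = (if i < n then y(i := y i - (\<Sum>j<n. A i j * y j) - z i) else y)"

text \<open>The sign of a letter is ignored since each generator acts as an involution.\<close>

definition aff_act :: "nat \<Rightarrow> (nat \<Rightarrow> nat \<Rightarrow> real) \<Rightarrow> (nat \<Rightarrow> real) \<Rightarrow> nat word \<Rightarrow> (nat \<Rightarrow> real) \<Rightarrow> nat \<Rightarrow> real" where
  "aff_act n A z w = foldr (\<lambda>(i, b). aff_refl n A z i) w"

lemma aff_act_Nil [simp]: "aff_act n A z [] y = y"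
  by (simp add: aff_act_def)

lemma aff_act_Cons [simp]: "aff_act n A z ((i, b) # w) y = aff_refl n A z i (aff_act n A z w y)"
  by (simp add: aff_act_def)

lemma aff_act_append: "aff_act n A z (u @ v) y = aff_act n A z u (aff_act n A z v y)"
  by (simp add: aff_act_def)

lemma sum_mult_if_eq:
  fixes a y :: "nat \<Rightarrow> real"
  assumes "i < n"
  shows "(\<Sum>j<n. a j * (if j = i then c else y j)) = (\<Sum>j<n. a j * y j) + a i * (c - y i)"
proof -
  have "(\<Sum>j<n. a j * (if j = i then c else y j)) = (\<Sum>j<n. a j * y j + (if j = i then a i * (c - y i) else 0))"
    by (intro sum.cong) (auto simp: algebra_simps)
  then show ?thesis using assms by (simp add: sum.distrib)
qed

lemma aff_refl_involution:
  assumes "A i i = 2"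
  shows "aff_refl n A z i (aff_refl n A z i y) = y"
  using assms by (auto simp: aff_refl_def sum_mult_if_eq)

text \<open>On the affine plane through \<open>y\<close> in the directions \<open>i\<close> and
  \<open>j\<close> the form has determinant \<open>D\<close>, which is nonzero, so the two
  reflections have a common fixed point there whatever \<open>z\<close> is. About it the composite
  is a rotation by twice \<open>\<theta>\<close>, up to a linear change of coordinates.\<close>

lemma aff_refl_dihedral:
  assumes ij: "i < n" "j < n" "i \<noteq> j"
    and A: "A i i = 2" "A j j = 2" "A i j = - 2 * cos \<theta>" "A j i = - 2 * cos \<theta>"
    and \<theta>: "sin \<theta> \<noteq> 0" "real k * \<theta> = pi"
  shows "((aff_refl n A z i \<circ> aff_refl n A z j) ^^ k) y = y"
proof -
  let ?f = "\<lambda>i y. (\<Sum>l<n. A i l * y l) + z i"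
  define D where "D = 4 * (sin \<theta>)\<^sup>2"
  have D: "D \<noteq> 0" "D = 4 - (2 * cos \<theta>)\<^sup>2"
    using \<theta>(1) by (simp add: D_def) (simp add: D_def sin_squared_eq power_mult_distrib)
  \<comment> \<open>the common fixed point of the two reflections in the plane through y\<close>
  define p where "p = - (2 * ?f i y + 2 * cos \<theta> * ?f j y) / D"
  define q where "q = - (2 * ?f j y + 2 * cos \<theta> * ?f i y) / D"
  define y0 where "y0 = y(i := y i + p, j := y j + q)"
  \<comment> \<open>Coordinates relative to the fixed point after \<open>l\<close> rounds. In the
    order \<open>Q 0\<close>, \<open>P 0\<close>, \<open>Q 1\<close>, \<open>P 1\<close> and so on
    they form one sequence in which each term is \<open>2 * cos \<theta>\<close> times its
    predecessor minus the term before that; the quotients of sines solve this recurrence with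
    initial values \<open>- q\<close> and \<open>- p\<close>.\<close>
  define P where "P l = (- p * sin ((2 * real l + 1) * \<theta>) + q * sin (2 * real l * \<theta>)) / sin \<theta>" for l
  define Q where "Q l = (- p * sin (2 * real l * \<theta>) + q * sin ((2 * real l - 1) * \<theta>)) / sin \<theta>" for l
  let ?y = "\<lambda>a b. y0(i := y0 i + a, j := y0 j + b)"
  have Dpq: "D * p = - (2 * ?f i y + 2 * cos \<theta> * ?f j y)" "D * q = - (2 * ?f j y + 2 * cos \<theta> * ?f i y)"
    using D(1) by (simp_all add: p_def q_def)
  have "D * (2 * p - 2 * cos \<theta> * q) = 2 * (D * p) - 2 * cos \<theta> * (D * q)"
    "D * (2 * q - 2 * cos \<theta> * p) = 2 * (D * q) - 2 * cos \<theta> * (D * p)"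
    by (simp_all add: algebra_simps)
  moreover have "2 * - (2 * a + 2 * cos \<theta> * b) - 2 * cos \<theta> * - (2 * b + 2 * cos \<theta> * a) = D * - a" for a b
    unfolding D(2) by (simp add: algebra_simps power2_eq_square)
  ultimately have "D * (2 * p - 2 * cos \<theta> * q) = D * - ?f i y" "D * (2 * q - 2 * cos \<theta> * p) = D * - ?f j y"
    unfolding Dpq by metis+
  then have pq: "2 * p - 2 * cos \<theta> * q = - ?f i y" "2 * q - 2 * cos \<theta> * p = - ?f j y"
    using D(1) mult_left_cancel[of D] by blast+
  have f0: "?f i y0 = 0" "?f j y0 = 0"
    using ij A pq by (simp_all add: y0_def sum_mult_if_eq)
  have ref: "aff_refl n A z j (?y a b) = ?y a (2 * cos \<theta> * a - b)"
    "aff_refl n A z i (?y a b) = ?y (2 * cos \<theta> * b - a) b" for a b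
    using ij A f0 by (auto simp: aff_refl_def sum_mult_if_eq fun_eq_iff algebra_simps)
  have step: "sin (x + \<theta>) = 2 * cos \<theta> * sin x - sin (x - \<theta>)" for x
    by (simp add: sin_add sin_diff)
  have sin_Suc: "sin (2 * real (Suc l) * \<theta>) = 2 * cos \<theta> * sin ((2 * real l + 1) * \<theta>) - sin (2 * real l * \<theta>)"
    "sin ((2 * real l + 1) * \<theta>) = 2 * cos \<theta> * sin (2 * real l * \<theta>) - sin ((2 * real l - 1) * \<theta>)" for l
    using step[of "(2 * real l + 1) * \<theta>"] step[of "2 * real l * \<theta>"] by (simp_all add: algebra_simps)
  have odd: "2 * real (Suc l) - 1 = 2 * real l + 1" for l by simp
  have Q: "Q (Suc l) = 2 * cos \<theta> * P l - Q l" for l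
    unfolding P_def Q_def odd sin_Suc(1) by (subst (2) sin_Suc(2)) (simp add: field_simps \<theta>(1))
  have P: "P (Suc l) = 2 * cos \<theta> * Q (Suc l) - P l" for l
    unfolding P_def Q_def sin_Suc(2)[of "Suc l"] odd sin_Suc(1) by (simp add: field_simps \<theta>(1))
  have iter: "((aff_refl n A z i \<circ> aff_refl n A z j) ^^ l) (?y (P 0) (Q 0)) = ?y (P l) (Q l)" for l
    by (induction l) (simp_all only: funpow.simps comp_apply id_apply ref Q P)
  have "P 0 = - p" "Q 0 = - q" using \<theta>(1) by (simp_all add: P_def Q_def)
  then have y: "?y (P 0) (Q 0) = y" using ij by (auto simp: y0_def)
  have "2 * real k * \<theta> = 2 * pi" using \<theta>(2) by simp
  then have k: "sin (2 * real k * \<theta>) = 0" "cos (2 * real k * \<theta>) = 1"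
    by (simp_all only: sin_two_pi cos_two_pi)
  have "P k = - p" "Q k = - q"
    using \<theta>(1) k by (simp_all add: P_def Q_def distrib_right left_diff_distrib sin_add sin_diff)
  then show ?thesis using iter[of k] y \<open>P 0 = - p\<close> \<open>Q 0 = - q\<close> by simp
qed

text \<open>Every Coxeter relation is an involution (\<open>i = j\<close>) or a dihedral relation
  with angle \<open>pi / k\<close>, and both hold for all \<open>z\<close>. The freedom in
  \<open>z\<close> is what makes the length bound work.\<close>

lemma aff_act_pres_eq:
  assumes m: "coxeter_matrix n m" and "pres_eq (coxeter_rels n m) u v"
  shows "aff_act n (cox_form m) z u y = aff_act n (cox_form m) z v y"
  using assms(2)
proof (induction arbitrary: y)
  case (pe_cancel u x b v)
  show ?case by (simp add: aff_act_append aff_refl_involution cox_form_def)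
next
  case (pe_rel l r u v)
  then obtain i j k where *: "l = concat (replicate k [(i, True), (j, True)])" "r = []"
      "i < n" "j < n" "m i j = enat k"
    unfolding coxeter_rels_def by blast
  let ?r = "aff_refl n (cox_form m) z"
  have act: "aff_act n (cox_form m) z (concat (replicate k [(i, True), (j, True)])) y = ((?r i \<circ> ?r j) ^^ k) y" for k y
    by (induction k) auto
  have "((?r i \<circ> ?r j) ^^ k) y = y" for y
  proof (cases "i = j")
    case True
    then have "k = 1" using m * by (simp add: coxeter_matrix_def one_enat_def)
    then show ?thesis using True by (simp add: aff_refl_involution cox_form_def)
  next
    case False
    then have "2 \<le> enat k" "m j i = enat k" using m * unfolding coxeter_matrix_def by metis+
    then have "2 \<le> k" by (simp add: numeral_eq_enat)
    moreover have "sin (pi / k) \<noteq> 0"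
      using \<open>2 \<le> k\<close> by (intro less_imp_neq[symmetric] sin_gt_zero) (simp_all add: field_simps)
    ultimately show ?thesis using * False \<open>m j i = enat k\<close>
      by (intro aff_refl_dihedral[where \<theta> = "pi / k"]) (simp_all add: cox_form_def)
  qed
  then show ?case using * by (simp add: aff_act_append act)
qed auto

lemma aff_refl_affine:
  "aff_refl n A z i (\<lambda>l. y l + c * d l) = (\<lambda>l. aff_refl n A z i y l + c * aff_refl n A (\<lambda>_. 0) i d l)"
  by (auto simp: aff_refl_def algebra_simps sum.distrib sum_distrib_left fun_eq_iff)

text \<open>The action with \<open>z = 0\<close> is the linear part of the action for an arbitrary
  \<open>z\<close>.\<close>

lemma aff_act_affine:
  "aff_act n A z w (\<lambda>l. y l + c * d l) = (\<lambda>l. aff_act n A z w y l + c * aff_act n A (\<lambda>_. 0) w d l)"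
  by (induction w arbitrary: y d) (auto simp: aff_refl_affine)

section \<open>Displacements caused by products of reflections\<close>

definition std_basis :: "nat \<Rightarrow> nat \<Rightarrow> real" where
  "std_basis i l = (if l = i then 1 else 0)"

definition refl_word :: "nat word \<times> nat \<Rightarrow> nat word" where
  "refl_word = (\<lambda>(g, i). g @ (i, True) # winv g)"

text \<open>A conjugate of a reflection moves all points along one direction, the image of a simple
  root under the linear part of the conjugator. Only the coefficient \<open>c\<close> depends on
  \<open>z\<close> and \<open>y\<close>.\<close>

lemma aff_act_refl_word:
  assumes "\<And>i. A i i = 2"
  obtains c where "aff_act n A z (refl_word (g, i)) y =
    (\<lambda>l. y l + c * aff_act n A (\<lambda>_. 0) g (std_basis i) l)"
proof -
  let ?x = "aff_act n A z (winv g) y"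
  have inv: "aff_act n A z g ?x = y"
  proof (induction g arbitrary: y)
    case (Cons a g)
    then show ?case by (cases a) (simp add: aff_act_append aff_refl_involution assms)
  qed simp
  obtain c where "aff_refl n A z i ?x = (\<lambda>l. ?x l + c * std_basis i l)"
    by (rule that[of "if i < n then - (\<Sum>j<n. A i j * ?x j) - z i else 0"])
       (auto simp: aff_refl_def std_basis_def)
  then show ?thesis
    using that[of c] by (simp add: refl_word_def aff_act_append aff_act_affine inv)
qed

text \<open>Real \<open>n\<close>-space is modelled inside all functions on the naturals, which
  gives access to the general results on span and independence.\<close>

interpretation real_fun: vector_space "\<lambda>(c :: real) (f :: nat \<Rightarrow> real) l. c * f l"
  by unfold_locales (auto simp: fun_eq_iff algebra_simps)

text \<open>Each factor adds a multiple of its own direction. The spanning set does not mention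
  \<open>z\<close>, so one subspace serves all translation vectors at once.\<close>

lemma aff_act_refl_words_span:
  assumes "\<And>i. A i i = 2"
  shows "aff_act n A z (concat (map refl_word gs)) y - y \<in>
    real_fun.span (set (map (\<lambda>(g, i). aff_act n A (\<lambda>_. 0) g (std_basis i)) gs))"
proof (induction gs)
  case (Cons p gs)
  obtain g i where p: "p = (g, i)" by fastforce
  let ?B = "\<lambda>gs. set (map (\<lambda>(g, i). aff_act n A (\<lambda>_. 0) g (std_basis i)) gs)"
  let ?x = "aff_act n A z (concat (map refl_word gs)) y"
  let ?a = "aff_act n A (\<lambda>_. 0) g (std_basis i)"
  obtain c where "aff_act n A z (refl_word p) ?x = (\<lambda>l. ?x l + c * ?a l)"
    using aff_act_refl_word[of A n z g i ?x] assms p by blast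
  then have "aff_act n A z (concat (map refl_word (p # gs))) y - y = (?x - y) + (\<lambda>l. c * ?a l)"
    by (auto simp: aff_act_append fun_eq_iff)
  moreover have "?x - y \<in> real_fun.span (?B (p # gs))"
    using Cons by (rule subsetD[OF real_fun.span_mono, rotated]) auto
  moreover have "(\<lambda>l. c * ?a l) \<in> real_fun.span (?B (p # gs))"
    using p by (intro real_fun.span_scale real_fun.span_base) auto
  ultimately show ?case using real_fun.span_add by metis
qed (simp add: real_fun.span_zero flip: zero_fun_def)

lemma sum_real_fun_apply: "(\<Sum>i\<in>I. f i) l = (\<Sum>i\<in>I. f i l)" for f :: "'a \<Rightarrow> nat \<Rightarrow> real"
  by (induction I rule: infinite_finite_induct) auto

text \<open>Solving for the translation part z coordinate by coordinate, starting from the last one.\<close>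

lemma aff_act_coxeter_surj:
  fixes y :: "nat \<Rightarrow> real"
  assumes supp: "\<And>l. n \<le> l \<Longrightarrow> y l = 0"
  obtains z where "aff_act n A z (map (\<lambda>i. (i, True)) [0..<n]) (\<lambda>_. 0) = y"
proof
  \<comment> \<open>When the reflection with index \<open>i\<close> acts, the coordinates above
    \<open>i\<close> already have their final values and all others are still 0; the condition that
    coordinate \<open>i\<close> becomes \<open>y i\<close> then determines
    \<open>?z i\<close>.\<close>
  let ?z = "\<lambda>i. - (\<Sum>j<n. A i j * (if i < j then y j else 0)) - y i"
  have "aff_act n A ?z (map (\<lambda>i. (i, True)) [k..<n]) (\<lambda>_. 0) = (\<lambda>l. if k \<le> l then y l else 0)"
    if "k \<le> n" for k
    using that
  proof (induction rule: inc_induct)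
    case base
    then show ?case using supp by auto
  next
    case (step k)
    have "(\<lambda>l. if Suc k \<le> l then y l else 0)(k := y k) = (\<lambda>l. if k \<le> l then y l else 0)"
      by auto
    then show ?case using step
      by (simp add: upt_conv_Cons aff_refl_def Suc_le_eq)
  qed
  from this[of 0] show "aff_act n A ?z (map (\<lambda>i. (i, True)) [0..<n]) (\<lambda>_. 0) = y" by simp
qed

text \<open>Every standard basis vector is the displacement of the origin for some \<open>z\<close>,
  and all these displacements lie in a span of at most \<open>length gs\<close> vectors. Comparing
  sizes gives the bound.\<close>

lemma coxeter_word_refl_length:
  assumes m: "coxeter_matrix n m"
    and eq: "pres_eq (coxeter_rels n m) (map (\<lambda>i. (i, True)) [0..<n]) (concat (map refl_word gs))"
  shows "n \<le> length gs"
proof -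
  let ?A = "cox_form m"
  let ?B = "set (map (\<lambda>(g, i). aff_act n ?A (\<lambda>_. 0) g (std_basis i)) gs)"
  let ?E = "std_basis ` {..<n}"
  have inj: "inj_on std_basis {..<n}"
    by (rule inj_onI) (auto simp: std_basis_def fun_eq_iff split: if_splits)
  have "real_fun.independent ?E"
  proof (rule real_fun.independent_if_scalars_zero)
    fix f x assume *: "(\<Sum>x\<in>?E. (\<lambda>l. f x * x l)) = 0" and "x \<in> ?E"
    then obtain i where i: "i < n" "x = std_basis i" by auto
    have "0 = (\<Sum>x\<in>?E. (\<lambda>l. f x * x l)) i" by (simp add: *)
    also have "\<dots> = (\<Sum>j<n. f (std_basis j) * std_basis j i)"
      by (simp add: sum_real_fun_apply sum.reindex[OF inj])
    also have "\<dots> = f (std_basis i)"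
      using i by (simp add: std_basis_def if_distrib cong: if_cong)
    finally show "f x = 0" using i by simp
  qed simp
  moreover have "?E \<subseteq> real_fun.span ?B"
  proof
    fix e assume "e \<in> ?E"
    then have "\<And>l. n \<le> l \<Longrightarrow> e l = 0" by (auto simp: std_basis_def)
    then obtain z where z: "aff_act n ?A z (map (\<lambda>i. (i, True)) [0..<n]) (\<lambda>_. 0) = e"
      by (rule aff_act_coxeter_surj)
    have "aff_act n ?A z (concat (map refl_word gs)) (\<lambda>_. 0) - (\<lambda>_. 0) \<in> real_fun.span ?B"
      by (rule aff_act_refl_words_span) (simp add: cox_form_def)
    then show "e \<in> real_fun.span ?B"
      using z aff_act_pres_eq[OF m eq, of z "\<lambda>_. 0"] by (simp add: fun_diff_def)
  qed
  ultimately have "card ?E \<le> card ?B"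
    using real_fun.independent_span_bound[of ?B ?E] by simp
  also have "\<dots> \<le> length gs"
    using card_length[of "map (\<lambda>(g, i). aff_act n ?A (\<lambda>_. 0) g (std_basis i)) gs"] by simp
  finally show ?thesis by (simp add: card_image[OF inj])
qed

section \<open>Reflection length in a Coxeter group\<close>

lemma (in group) mult_pow_shift:
  assumes "a \<in> carrier G" "b \<in> carrier G"
  shows "a \<otimes> (b \<otimes> a) [^] (p :: nat) = (a \<otimes> b) [^] p \<otimes> a"
proof (induction p)
  case (Suc p)
  have "a \<otimes> (b \<otimes> a) [^] Suc p = a \<otimes> (b \<otimes> a) [^] p \<otimes> (b \<otimes> a)"
    using assms by (simp add: m_assoc)
  then show ?case using Suc assms by (simp add: m_assoc)
qed (use assms in simp)

lemma alt_word_0 [simp]: "alt_word a b 0 = []"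
  by (simp add: alt_word_def)

lemma alt_word_Suc: "alt_word a b (Suc k) = (a, True) # alt_word b a k"
  by (simp add: alt_word_def map_upt_Suc del: upt_Suc)

lemma (in group) word_ev_alt_word_even:
  assumes "f a \<in> carrier G" "f b \<in> carrier G"
  shows "word_ev G f (alt_word a b (2 * p)) = (f a \<otimes> f b) [^] p"
proof (induction p)
  case (Suc p)
  then show ?case
    using assms nat_pow_Suc2[of "f a \<otimes> f b" p] by (simp add: alt_word_Suc m_assoc)
qed simp

context group
begin

context
  fixes x :: "nat \<Rightarrow> 'a" and d :: 'a
  assumes x: "\<And>l. x l \<in> carrier G" and d: "\<And>l. x l \<otimes> x (Suc l) = d"
begin

lemma constant_product_carrier: "d \<in> carrier G"
  using x d[of 0] by (metis m_closed)

text \<open>Bracketing \<open>x l\<close>, \<open>x (l + 1)\<close>, \<open>x (l + 2)\<close> in two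
  ways shows that passing \<open>d\<close> from right to left shifts the index by two.\<close>

lemma constant_product_shift: "x l \<otimes> d [^] p = d [^] p \<otimes> x (l + 2 * p)"
proof (induction p)
  case (Suc p)
  have "x (l + 2 * p) \<otimes> d = d \<otimes> x (l + 2 * Suc p)"
    using d[of "l + 2 * p"] d[of "Suc (l + 2 * p)"] x by (simp flip: m_assoc) (metis m_assoc)
  moreover have "x l \<otimes> d [^] Suc p = d [^] p \<otimes> (x (l + 2 * p) \<otimes> d)"
    using Suc x constant_product_carrier by (simp add: m_assoc[symmetric])
  ultimately show ?case using x constant_product_carrier by (simp add: m_assoc)
qed (use x in simp)

lemma constant_product_artin_relation:
  assumes per: "x (if even k then Suc k else k) = x (if even k then 1 else 0)"
    and f: "f i = x 0" "f j = x 1"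
  shows "word_ev G f (alt_word i j k) = word_ev G f (alt_word j i k)"
proof (cases "even k")
  case True
  then obtain p where k: "k = 2 * p" by auto
  have "(x 1 \<otimes> x 0) [^] p \<otimes> x 1 = d [^] p \<otimes> x 1"
    using mult_pow_shift[of "x 1" "x 0" p] constant_product_shift[of 1 p] per x d[of 0] k by simp
  then have "(x 0 \<otimes> x 1) [^] p = (x 1 \<otimes> x 0) [^] p"
    using x d[of 0] constant_product_carrier by simp
  then show ?thesis using x f unfolding k by (simp add: word_ev_alt_word_even)
next
  case False
  then obtain p where k: "k = Suc (2 * p)" using oddE by fastforce
  have "x 0 \<otimes> (x 1 \<otimes> x 0) [^] p = x 1 \<otimes> (x 0 \<otimes> x 1) [^] p"
    using mult_pow_shift[of "x 0" "x 1" p] constant_product_shift[of 1 p] per x d[of 0] k by simp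
  then show ?thesis using x f unfolding k by (simp add: alt_word_Suc word_ev_alt_word_even)
qed

text \<open>For involutions \<open>x 1\<close> inverts \<open>d\<close>, hence
  \<open>d [^] (2 * p)\<close> times \<open>x (2 * p + 1)\<close> is \<open>x 1\<close>. With
  \<open>d [^] k\<close> trivial this gives the period, after one more factor \<open>d\<close> when
  \<open>k\<close> is odd.\<close>

lemma constant_product_period:
  assumes inv: "\<And>l. x l \<otimes> x l = \<one>" and dk: "d [^] k = \<one>"
  shows "x (if even k then Suc k else k) = x (if even k then 1 else 0)"
proof -
  note c = x constant_product_carrier
  have "d \<otimes> x 1 \<otimes> d = x 1"
    using inv[of 1] inv[of 0] x unfolding d[of 0, symmetric]
    by (simp add: m_assoc) (simp add: m_assoc[symmetric])
  then have conj: "d [^] p \<otimes> x 1 \<otimes> d [^] p = x 1" for p :: nat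
  proof (induction p)
    case (Suc p)
    have "d [^] Suc p \<otimes> x 1 \<otimes> d [^] Suc p = d \<otimes> (d [^] p \<otimes> x 1 \<otimes> d [^] p) \<otimes> d"
      using c by (subst nat_pow_Suc2) (simp_all add: m_assoc)
    then show ?case using Suc by simp
  qed (use c in simp)
  have shift: "d [^] (2 * p) \<otimes> x (Suc (2 * p)) = x 1" for p :: nat
  proof -
    have "d [^] (2 * p) \<otimes> x (Suc (2 * p)) = d [^] p \<otimes> (d [^] p \<otimes> x (1 + 2 * p))"
      using c by (simp add: mult_2 flip: nat_pow_mult) (simp add: m_assoc)
    moreover have "d [^] p \<otimes> x (1 + 2 * p) = x 1 \<otimes> d [^] p"
      by (simp only: constant_product_shift)
    ultimately show ?thesis using conj[of p] c by (simp add: m_assoc)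
  qed
  show ?thesis
  proof (cases "even k")
    case True
    then obtain p where k: "k = 2 * p" by auto
    then show ?thesis using shift[of p] dk c by simp
  next
    case False
    then obtain p where k: "k = Suc (2 * p)" using oddE by fastforce
    have "d \<otimes> (d [^] (2 * p) \<otimes> x k) = d \<otimes> x 1" using shift[of p] k by simp
    also have "\<dots> = x 0" using inv[of 1] x unfolding d[of 0, symmetric] by (simp add: m_assoc)
    also have "d \<otimes> (d [^] (2 * p) \<otimes> x k) = d [^] k \<otimes> x k"
      using c unfolding k by (subst nat_pow_Suc2) (simp_all add: m_assoc)
    finally show ?thesis using dk c False by simp
  qed
qed

end

end

lemma upt_split_at: "k \<le> i \<Longrightarrow> i < n \<Longrightarrow> [k..<n] = [k..<i] @ i # [Suc i..<n]"
  using upt_add_eq_append[of k i "n - i"] by (simp add: upt_conv_Cons)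

section \<open>Reflections and reflection factorizations in a Coxeter system\<close>

locale coxeter_sys =
  fixes W :: "('g, 'b) monoid_scheme" and n :: nat and s :: "nat \<Rightarrow> 'g" and m :: "nat \<Rightarrow> nat \<Rightarrow> enat"
  assumes coxeter_system: "coxeter_system W n s m"
begin

sublocale W: group W
  using coxeter_system by (simp add: coxeter_system_def)

abbreviation T :: "'g set" where "T \<equiv> reflections W n s"
abbreviation h :: 'g where "h \<equiv> word_prod W (map s [0..<n])"
abbreviation words :: "nat word set" where "words \<equiv> lists ({..<n} \<times> UNIV)"

lemma coxeter_matrix: "coxeter_matrix n m"
  using coxeter_system by (simp add: coxeter_system_def)

lemma s_carrier:
  assumes "i < n"
  shows "s i \<in> carrier W"
proof -
  obtain \<phi> where \<phi>: "\<phi> \<in> iso (pres_group {..<n} (coxeter_rels n m)) W"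
    "\<forall>i<n. \<phi> (pclass {..<n} (coxeter_rels n m) [(i, True)]) = s i"
    using coxeter_system unfolding coxeter_system_def by blast
  have "pclass {..<n} (coxeter_rels n m) [(i, True)] \<in> carrier (pres_group {..<n} (coxeter_rels n m))"
    using assms by (intro pclass_carrier) simp
  then show ?thesis using \<phi> assms by (metis hom_in_carrier iso_imp_homomorphism)
qed

lemma presentation:
  obtains \<phi> where "\<phi> \<in> iso (pres_group {..<n} (coxeter_rels n m)) W"
    "\<And>w. w \<in> words \<Longrightarrow> \<phi> (pclass {..<n} (coxeter_rels n m) w) = word_ev W s w"
proof -
  obtain \<phi> where \<phi>: "\<phi> \<in> iso (pres_group {..<n} (coxeter_rels n m)) W"
    "\<forall>i<n. \<phi> (pclass {..<n} (coxeter_rels n m) [(i, True)]) = s i"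
    using coxeter_system unfolding coxeter_system_def by blast
  then have hom: "\<phi> \<in> hom (pres_group {..<n} (coxeter_rels n m)) W" by (simp add: iso_def)
  have "\<phi> (pclass {..<n} (coxeter_rels n m) w) = word_ev W s w" if w: "w \<in> words" for w
    unfolding hom_pclass[OF W.is_group hom w] by (rule word_ev_cong[OF w]) (use \<phi>(2) in auto)
  with \<phi>(1) show thesis by (rule that)
qed

lemma s_Pi: "s \<in> {..<n} \<rightarrow> carrier W"
  using s_carrier by auto

lemma word_surj:
  assumes "g \<in> carrier W"
  obtains w where "w \<in> words" "g = word_ev W s w"
proof -
  obtain \<phi> where \<phi>: "\<phi> \<in> iso (pres_group {..<n} (coxeter_rels n m)) W"
    and ev: "\<And>w. w \<in> words \<Longrightarrow> \<phi> (pclass {..<n} (coxeter_rels n m) w) = word_ev W s w"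
    by (rule presentation) (rule that)
  have "g \<in> \<phi> ` carrier (pres_group {..<n} (coxeter_rels n m))"
    using \<phi> assms by (simp add: iso_def bij_betw_def)
  then obtain w where "w \<in> words" "g = \<phi> (pclass {..<n} (coxeter_rels n m) w)"
    unfolding carrier_pres_group by blast
  then show thesis using ev that by metis
qed

lemma word_ev_eq_iff:
  assumes "u \<in> words" "v \<in> words"
  shows "word_ev W s u = word_ev W s v \<longleftrightarrow> pres_eq (coxeter_rels n m) u v"
proof -
  obtain \<phi> where \<phi>: "\<phi> \<in> iso (pres_group {..<n} (coxeter_rels n m)) W"
    and ev: "\<And>w. w \<in> words \<Longrightarrow> \<phi> (pclass {..<n} (coxeter_rels n m) w) = word_ev W s w"
    by (rule presentation) (rule that)
  have "inj_on \<phi> (carrier (pres_group {..<n} (coxeter_rels n m)))"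
    using \<phi> by (simp add: iso_def bij_betw_def)
  then show ?thesis
    using assms pclass_carrier unfolding ev[OF assms(1), symmetric] ev[OF assms(2), symmetric]
    by (simp add: inj_on_eq_iff pclass_carrier pclass_eq_iff)
qed

lemma s_mult_pow:
  assumes "i < n" "j < n" "m i j = enat k"
  shows "(s i \<otimes>\<^bsub>W\<^esub> s j) [^]\<^bsub>W\<^esub> k = \<one>\<^bsub>W\<^esub>"
proof -
  let ?w = "\<lambda>k. concat (replicate k [(i, True), (j, True)])"
  have w: "?w k \<in> words" for k using assms by (induction k) auto
  have "word_ev W s (?w k) = (s i \<otimes>\<^bsub>W\<^esub> s j) [^]\<^bsub>W\<^esub> k" for k
  proof (induction k)
    case (Suc k)
    then show ?case
      using s_carrier assms(1,2) W.nat_pow_Suc2[of "s i \<otimes>\<^bsub>W\<^esub> s j" k] by (simp add: W.m_assoc)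
  qed simp
  moreover have "pres_eq (coxeter_rels n m) (?w k) []"
    using pe_rel[of "?w k" "[]" "coxeter_rels n m" "[]" "[]"] assms by (auto simp: coxeter_rels_def)
  then have "word_ev W s (?w k) = word_ev W s []"
    by (subst word_ev_eq_iff[OF w]) simp_all
  ultimately show ?thesis by simp
qed

lemma s_involution: "i < n \<Longrightarrow> s i \<otimes>\<^bsub>W\<^esub> s i = \<one>\<^bsub>W\<^esub>"
  using s_mult_pow[of i i 1] s_carrier[of i] coxeter_matrix by (simp add: coxeter_matrix_def one_enat_def)

lemma T_conj:
  assumes "t \<in> T" "g \<in> carrier W"
  shows "g \<otimes>\<^bsub>W\<^esub> t \<otimes>\<^bsub>W\<^esub> inv\<^bsub>W\<^esub> g \<in> T"
proof -
  obtain f i where t: "t = f \<otimes>\<^bsub>W\<^esub> s i \<otimes>\<^bsub>W\<^esub> inv\<^bsub>W\<^esub> f" "f \<in> carrier W" "i < n"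
    using assms(1) by (auto simp: reflections_def)
  have "g \<otimes>\<^bsub>W\<^esub> t \<otimes>\<^bsub>W\<^esub> inv\<^bsub>W\<^esub> g = (g \<otimes>\<^bsub>W\<^esub> f) \<otimes>\<^bsub>W\<^esub> s i \<otimes>\<^bsub>W\<^esub> inv\<^bsub>W\<^esub> (g \<otimes>\<^bsub>W\<^esub> f)"
    using t assms(2) s_carrier by (simp add: W.group_normalize)
  then show ?thesis using t assms(2) unfolding reflections_def by blast
qed

lemma T_conj':
  assumes "t \<in> T" "g \<in> carrier W"
  shows "inv\<^bsub>W\<^esub> g \<otimes>\<^bsub>W\<^esub> t \<otimes>\<^bsub>W\<^esub> g \<in> T"
  using T_conj[OF assms(1), of "inv\<^bsub>W\<^esub> g"] assms(2) by simp

lemma T_carrier: "T \<subseteq> carrier W"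
  using s_carrier by (auto simp: reflections_def)

lemma s_T: "i < n \<Longrightarrow> s i \<in> T"
  using s_carrier[of i] by (auto simp: reflections_def intro!: exI[of _ "\<one>\<^bsub>W\<^esub>"] exI[of _ i])

lemma T_involution:
  assumes "t \<in> T"
  shows "t \<otimes>\<^bsub>W\<^esub> t = \<one>\<^bsub>W\<^esub>"
proof -
  obtain f i where t: "t = f \<otimes>\<^bsub>W\<^esub> s i \<otimes>\<^bsub>W\<^esub> inv\<^bsub>W\<^esub> f" "f \<in> carrier W" "i < n"
    using assms(1) by (auto simp: reflections_def)
  have "s i \<otimes>\<^bsub>W\<^esub> (s i \<otimes>\<^bsub>W\<^esub> x) = x" if "x \<in> carrier W" for x
    using t that s_carrier s_involution by (simp flip: W.m_assoc)
  then show ?thesis using t s_carrier by (simp add: W.group_normalize)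
qed

lemma T_inv: "t \<in> T \<Longrightarrow> inv\<^bsub>W\<^esub> t = t"
  using T_involution T_carrier by (intro W.inv_equality) auto

lemma T_hurwitz:
  "x \<in> T \<Longrightarrow> y \<in> T \<Longrightarrow> x \<otimes>\<^bsub>W\<^esub> y \<otimes>\<^bsub>W\<^esub> inv\<^bsub>W\<^esub> x \<in> T \<and> inv\<^bsub>W\<^esub> x \<otimes>\<^bsub>W\<^esub> y \<otimes>\<^bsub>W\<^esub> x \<in> T"
  using T_conj T_conj' T_carrier by auto

text \<open>Reflections are their own inverses, so the inverse letters allowed in
  \<open>reps\<close> add nothing.\<close>

lemma reps_iff: "xs \<in> reps W T a k \<longleftrightarrow> length xs = k \<and> set xs \<subseteq> T \<and> word_prod W xs = a"
proof -
  have "(\<lambda>x. inv\<^bsub>W\<^esub> x) ` T = T" using T_inv by force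
  then show ?thesis by (simp add: reps_def)
qed

lemma wlen_le: "set xs \<subseteq> T \<Longrightarrow> wlen W T (word_prod W xs) \<le> length xs"
  unfolding wlen_def by (rule Least_le) (use reps_iff in blast)

lemma Red_iff: "xs \<in> Red W T a \<longleftrightarrow> length xs = wlen W T a \<and> set xs \<subseteq> T \<and> word_prod W xs = a"
  by (simp add: Red_def reps_iff)

lemma Red_exists:
  assumes "a \<in> carrier W"
  obtains xs where "xs \<in> Red W T a"
proof -
  obtain w where w: "w \<in> words" "a = word_ev W s w" using assms by (rule word_surj)
  have "word_ev W s w = word_prod W (map (s \<circ> fst) w) \<and> set (map (s \<circ> fst) w) \<subseteq> T"
    using w(1) by (induction w) (auto simp: s_T T_inv)
  then have "map (s \<circ> fst) w \<in> reps W T a (length w)" using w(2) by (simp only: reps_iff length_map)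
  then have "reps W T a (length w) \<noteq> {}" by blast
  then have "reps W T a (wlen W T a) \<noteq> {}" unfolding wlen_def by (rule LeastI)
  then show thesis using that by (auto simp: Red_def)
qed

lemma word_prod_T [simp]: "set xs \<subseteq> T \<Longrightarrow> word_prod W xs \<in> carrier W"
  using T_carrier by (intro W.word_prod_closed) auto

lemma word_prod_append_T:
  "set xs \<subseteq> T \<Longrightarrow> set ys \<subseteq> T \<Longrightarrow> word_prod W (xs @ ys) = word_prod W xs \<otimes>\<^bsub>W\<^esub> word_prod W ys"
  using T_carrier by (intro W.word_prod_append) auto

lemma set_s: "set (map s [i..<n]) \<subseteq> T"
  using s_T by auto

lemma h_carrier [simp]: "h \<in> carrier W"
  using set_s by (rule word_prod_T)

lemma word_ev_winv:
  assumes "w \<in> words"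
  shows "word_ev W s (winv w) = inv\<^bsub>W\<^esub> (word_ev W s w)"
proof -
  note w = W.word_ev_closed[OF s_Pi]
  have "word_ev W s (w @ winv w) = word_ev W s []"
    using assms by (subst word_ev_eq_iff) (auto simp: pres_eq_winv_right)
  then have "word_ev W s w \<otimes>\<^bsub>W\<^esub> word_ev W s (winv w) = \<one>\<^bsub>W\<^esub>"
    using W.word_ev_append[OF s_Pi assms winv_lists[OF assms]] by simp
  then show ?thesis
    using w[OF assms] w[OF winv_lists[OF assms]] by (metis W.inv_equality W.inv_inv)
qed

lemma T_refl_word:
  assumes "t \<in> T"
  obtains p where "refl_word p \<in> words" "word_ev W s (refl_word p) = t"
proof -
  obtain f i where t: "t = f \<otimes>\<^bsub>W\<^esub> s i \<otimes>\<^bsub>W\<^esub> inv\<^bsub>W\<^esub> f" "f \<in> carrier W" "i < n"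
    using assms(1) by (auto simp: reflections_def)
  obtain g where g: "g \<in> words" "f = word_ev W s g" using t(2) by (rule word_surj)
  have i: "(i, True) # winv g \<in> words" using g(1) t(3) winv_lists[of g "{..<n}"] by simp
  have "refl_word (g, i) \<in> words" using g(1) i by (simp add: refl_word_def)
  moreover have "word_ev W s (refl_word (g, i)) = t"
    unfolding refl_word_def using g t s_carrier W.word_ev_append[OF s_Pi g(1) i]
    by (simp add: word_ev_winv W.m_assoc)
  ultimately show thesis by (rule that)
qed

text \<open>For the lower bound, a reduced factorization is written as a concatenation of conjugate
  words. This word is equivalent to the Coxeter word, so the displacement argument bounds its number
  of factors.\<close>

lemma wlen_h: "wlen W T h = n"
proof (rule antisym)
  show "wlen W T h \<le> n" using wlen_le[OF set_s[of 0]] by simp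
  obtain xs where xs: "xs \<in> Red W T h" using Red_exists h_carrier by blast
  have "set xs \<subseteq> T" using xs by (simp add: Red_iff)
  then have "\<exists>gs. length gs = length xs \<and> concat (map refl_word gs) \<in> words
    \<and> word_ev W s (concat (map refl_word gs)) = word_prod W xs"
  proof (induction xs)
    case (Cons t xs)
    then obtain gs where gs: "length gs = length xs" "concat (map refl_word gs) \<in> words"
      "word_ev W s (concat (map refl_word gs)) = word_prod W xs" by auto
    obtain p where p: "refl_word p \<in> words" "word_ev W s (refl_word p) = t"
      using Cons.prems T_refl_word[of t] by auto
    show ?case
      using gs p W.word_ev_append[OF s_Pi p(1) gs(2)]
      by (intro exI[of _ "p # gs"]) simp
  qed simp
  then obtain gs where gs: "length gs = length xs" "concat (map refl_word gs) \<in> words"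
    "word_ev W s (concat (map refl_word gs)) = word_prod W xs" by blast
  have "word_ev W s (map (\<lambda>i. (i, True)) [0..<n]) = word_ev W s (concat (map refl_word gs))"
    using xs gs(3) by (simp add: Red_iff word_ev_positive)
  then have "n \<le> length gs"
    using gs(2) by (intro coxeter_word_refl_length[OF coxeter_matrix]) (subst (asm) word_ev_eq_iff; auto)
  then show "n \<le> wlen W T h" using gs(1) xs by (simp add: Red_iff)
qed

lemma Red_h_iff: "xs \<in> Red W T h \<longleftrightarrow> length xs = n \<and> set xs \<subseteq> T \<and> word_prod W xs = h"
  by (simp add: Red_iff wlen_h)

text \<open>A trivial reflection would make some \<open>s i\<close> trivial; deleting it from the
  Coxeter word would contradict \<open>wlen_h\<close>.\<close>

lemma one_not_T: "\<one>\<^bsub>W\<^esub> \<notin> T"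
proof
  assume "\<one>\<^bsub>W\<^esub> \<in> T"
  then obtain g i where g: "\<one>\<^bsub>W\<^esub> = g \<otimes>\<^bsub>W\<^esub> s i \<otimes>\<^bsub>W\<^esub> inv\<^bsub>W\<^esub> g" "g \<in> carrier W" "i < n"
    by (auto simp: reflections_def)
  have "s i = inv\<^bsub>W\<^esub> g \<otimes>\<^bsub>W\<^esub> (g \<otimes>\<^bsub>W\<^esub> s i \<otimes>\<^bsub>W\<^esub> inv\<^bsub>W\<^esub> g) \<otimes>\<^bsub>W\<^esub> g"
    using g(2,3) s_carrier by (simp add: W.group_normalize)
  then have "s i = \<one>\<^bsub>W\<^esub>" using g(2) unfolding g(1)[symmetric] by simp
  moreover have sp: "[0..<n] = [0..<i] @ i # [Suc i..<n]"
    using g(3) by (simp add: upt_split_at)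
  have T: "set (map s [0..<i]) \<subseteq> T" "set (map s [Suc i..<n]) \<subseteq> T" "s i \<in> T"
    using s_T g(3) by auto
  ultimately have "h = word_prod W (map s [0..<i] @ map s [Suc i..<n])"
    unfolding sp by (simp add: word_prod_append_T)
  then have "n \<le> length (map s [0..<i] @ map s [Suc i..<n])"
    using wlen_le[of "map s [0..<i] @ map s [Suc i..<n]"] T wlen_h by auto
  then show False using g(3) by simp
qed

text \<open>If either part had a shorter factorization, concatenation would give one of
  \<open>h\<close> with fewer than \<open>n\<close> factors.\<close>

lemma Red_h_prefix:
  assumes "u @ v \<in> Red W T h"
  shows "u \<in> Red W T (word_prod W u)" "v \<in> Red W T (word_prod W v)"
    "word_prod W u \<in> interval1 W T h" "inv\<^bsub>W\<^esub> (word_prod W u) \<otimes>\<^bsub>W\<^esub> h = word_prod W v"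
proof -
  have u: "set u \<subseteq> T" "set v \<subseteq> T" "length u + length v = n" "word_prod W (u @ v) = h"
    using assms by (simp_all add: Red_h_iff)
  obtain u' v' where u': "u' \<in> Red W T (word_prod W u)" "v' \<in> Red W T (word_prod W v)"
    using u Red_exists word_prod_T by metis
  then have "word_prod W (u' @ v') = h" "set (u' @ v') \<subseteq> T"
    using u by (simp_all add: Red_iff word_prod_append_T)
  then have "n \<le> wlen W T (word_prod W u) + wlen W T (word_prod W v)"
    using wlen_le[of "u' @ v'"] u' by (simp add: wlen_h Red_iff)
  moreover have "wlen W T (word_prod W u) \<le> length u" "wlen W T (word_prod W v) \<le> length v"
    using u wlen_le by auto
  ultimately have l: "wlen W T (word_prod W u) = length u" "wlen W T (word_prod W v) = length v"
    using u(3) by auto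
  show "inv\<^bsub>W\<^esub> (word_prod W u) \<otimes>\<^bsub>W\<^esub> h = word_prod W v"
    using u unfolding u(4)[symmetric] by (simp add: word_prod_append_T W.mult_inv_cancel)
  then show "u \<in> Red W T (word_prod W u)" "v \<in> Red W T (word_prod W v)"
    "word_prod W u \<in> interval1 W T h"
    using l u by (simp_all add: Red_iff interval1_def wlen_h)
qed

lemma Red_h_append:
  assumes "a \<in> interval1 W T h" "u \<in> Red W T a" "v \<in> Red W T (inv\<^bsub>W\<^esub> a \<otimes>\<^bsub>W\<^esub> h)"
  shows "u @ v \<in> Red W T h"
  using assms by (auto simp: Red_iff interval1_def word_prod_append_T W.mult_inv_cancel)

text \<open>The block \<open>u\<close> is carried past \<open>v\<close> by conjugating its letters
  with the product of \<open>v\<close>; conjugates of reflections are reflections, and the length is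
  unchanged.\<close>

lemma Red_h_swap:
  assumes "p @ u @ v @ q \<in> Red W T h"
  obtains u' where "p @ v @ u' @ q \<in> Red W T h"
proof -
  have T: "set p \<subseteq> T" "set u \<subseteq> T" "set v \<subseteq> T" "set q \<subseteq> T"
    using assms by (simp_all add: Red_h_iff)
  define g where "g = word_prod W v"
  have g: "g \<in> carrier W" using T by (simp add: g_def)
  let ?u = "map (\<lambda>t. inv\<^bsub>W\<^esub> g \<otimes>\<^bsub>W\<^esub> t \<otimes>\<^bsub>W\<^esub> g) u"
  have u: "set ?u \<subseteq> T" using T_conj' T(2) g by auto
  have "word_prod W ?u = inv\<^bsub>W\<^esub> g \<otimes>\<^bsub>W\<^esub> word_prod W u \<otimes>\<^bsub>W\<^esub> g"
    using T(2)
  proof (induction u)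
    case (Cons t u)
    then have "t \<in> carrier W" "word_prod W u \<in> carrier W" using T_carrier by auto
    then show ?case using Cons g by (simp add: W.group_normalize)
  qed (use g in simp)
  then have "word_prod W (p @ v @ ?u @ q) = word_prod W (p @ u @ v @ q)"
    using T u g by (simp add: word_prod_append_T W.group_normalize del: set_map flip: g_def)
  then have "p @ v @ ?u @ q \<in> Red W T h" using assms T u by (simp add: Red_h_iff del: set_map)
  then show thesis by (rule that)
qed

lemma Red_h_middle:
  assumes "p @ v @ q \<in> Red W T h"
  shows "v \<in> Red W T (word_prod W v)" "word_prod W v \<in> interval1 W T h"
proof -
  obtain p' where "v @ p' @ q \<in> Red W T h" using Red_h_swap[of "[]" p v q] assms by auto
  then show "v \<in> Red W T (word_prod W v)" "word_prod W v \<in> interval1 W T h"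
    by (rule Red_h_prefix)+
qed

lemma Red_h_letter:
  assumes "xs \<in> Red W T h" "t \<in> set xs"
  shows "t \<in> T \<inter> interval1 W T h"
proof -
  obtain p q where xs: "xs = p @ [t] @ q" using assms(2) by (auto dest: split_list)
  have "t \<in> T" using assms by (auto simp: Red_h_iff)
  then show ?thesis using Red_h_middle(2)[of p "[t]" q] assms(1) xs T_carrier by auto
qed

lemma Red_letter:
  assumes "a \<in> interval1 W T h" "u \<in> Red W T a"
  shows "set u \<subseteq> T \<inter> interval1 W T h"
proof -
  have "inv\<^bsub>W\<^esub> a \<otimes>\<^bsub>W\<^esub> h \<in> carrier W" using assms(1) by (simp add: interval1_def)
  then obtain v where "v \<in> Red W T (inv\<^bsub>W\<^esub> a \<otimes>\<^bsub>W\<^esub> h)" using Red_exists by blast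
  then show ?thesis using Red_h_letter[OF Red_h_append[OF assms]] by auto
qed

text \<open>Since 1 is not a reflection, \<open>t\<close> has reflection length one, so a reduced
  factorization of the complement of \<open>t\<close> completes it.\<close>

lemma Red_h_Cons_exists:
  assumes "t \<in> T \<inter> interval1 W T h"
  obtains xs where "t # xs \<in> Red W T h"
proof -
  have t: "t \<in> T" "t \<in> carrier W" using assms T_carrier by auto
  have "wlen W T t \<noteq> 0"
  proof
    assume "wlen W T t = 0"
    moreover obtain xs where "xs \<in> Red W T t" using t Red_exists by blast
    ultimately show False using t one_not_T by (auto simp: Red_iff)
  qed
  then have "[t] \<in> Red W T t" using t wlen_le[of "[t]"] by (simp add: Red_iff)
  moreover obtain v where "v \<in> Red W T (inv\<^bsub>W\<^esub> t \<otimes>\<^bsub>W\<^esub> h)"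
    using t Red_exists[of "inv\<^bsub>W\<^esub> t \<otimes>\<^bsub>W\<^esub> h"] by auto
  ultimately have "[t] @ v \<in> Red W T h" using assms by (intro Red_h_append[of t]) auto
  then show thesis using that by simp
qed

lemma h_interval: "h \<in> interval1 W T h"
  using Red_h_prefix(3)[of "map s [0..<n]" "[]"] set_s[of 0] by (simp add: Red_h_iff)

lemma s_Red_h: "map s [0..<n] \<in> Red W T h"
  using set_s[of 0] by (simp add: Red_h_iff)

lemma hurwitz_Red_h:
  assumes "xs \<in> Red W T h" "w \<in> lists ({1..<n} \<times> UNIV)"
  shows "hurwitz W w xs \<in> Red W T h"
  using assms hurwitz_closed[of T W xs w] W.hurwitz_word_prod[of xs w] T_hurwitz T_carrier
  unfolding Red_h_iff by (metis length_hurwitz order_trans)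

lemma s_pair_Red_h:
  assumes "i < j" "j < n"
  obtains q where "[s i, s j] @ q \<in> Red W T h"
proof -
  have "[0..<n] = [0..<i] @ [i] @ [Suc i..<j] @ [j] @ [Suc j..<n]"
    using assms upt_split_at[of 0 i n] upt_split_at[of "Suc i" j n] by simp
  then have "map s [0..<i] @ [s i] @ map s [Suc i..<j] @ [s j] @ map s [Suc j..<n] \<in> Red W T h"
    using s_Red_h by (metis list.simps(8,9) map_append)
  then obtain u where "[s i] @ u @ map s [Suc i..<j] @ [s j] @ map s [Suc j..<n] \<in> Red W T h"
    using Red_h_swap[of "[]" "map s [0..<i]" "[s i]"] by auto
  then obtain v where "[s i] @ [s j] @ v @ map s [Suc j..<n] \<in> Red W T h"
    using Red_h_swap[of "[s i]" "u @ map s [Suc i..<j]" "[s j]" "map s [Suc j..<n]"] by auto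
  then show thesis using that by simp
qed

end

section \<open>Lifting factorizations to the Artin group\<close>

text \<open>For involutions \<open>a\<close> and \<open>b\<close> this runs through reflections of
  the dihedral group they generate, with neighbours having the constant product of \<open>a\<close>
  and \<open>b\<close>. Conjugation is written without an inverse for that reason.\<close>

fun dihedral_seq :: "('g, 'b) monoid_scheme \<Rightarrow> 'g \<Rightarrow> 'g \<Rightarrow> nat \<Rightarrow> 'g" where
  "dihedral_seq G a b 0 = a"
| "dihedral_seq G a b (Suc 0) = b"
| "dihedral_seq G a b (Suc (Suc l)) =
     dihedral_seq G a b (Suc l) \<otimes>\<^bsub>G\<^esub> dihedral_seq G a b l \<otimes>\<^bsub>G\<^esub> dihedral_seq G a b (Suc l)"

section \<open>Hurwitz moves and Artin relations in the dual Artin group\<close>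

context coxeter_sys
begin

abbreviation T\<^sub>h :: "'g set" where "T\<^sub>h \<equiv> T \<inter> interval1 W T h"
abbreviation D :: "'g word set monoid" where "D \<equiv> dual_artin_group W T h"
abbreviation dg :: "'g \<Rightarrow> 'g word set" where "dg t \<equiv> pclass T\<^sub>h (dual_artin_rels W T h) [(t, True)]"
abbreviation A :: "nat word set monoid" where "A \<equiv> artin_group n m"
abbreviation ag :: "nat \<Rightarrow> nat word set" where "ag \<equiv> artin_gen n m"

sublocale D: group D by (simp add: dual_artin_group_def)
sublocale A: group A by (simp add: artin_group_def)

lemma dg_carrier: "t \<in> T\<^sub>h \<Longrightarrow> dg t \<in> carrier D"
  unfolding dual_artin_group_def by (rule pclass_carrier) simp

lemma ag_carrier: "i < n \<Longrightarrow> ag i \<in> carrier A"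
  unfolding artin_group_def artin_gen_def by (rule pclass_carrier) simp

lemma dual_artin_rels_lists: "dual_artin_rels W T h \<subseteq> lists (T\<^sub>h \<times> UNIV) \<times> lists (T\<^sub>h \<times> UNIV)"
proof -
  have "map (\<lambda>t. (t, True)) u \<in> lists (T\<^sub>h \<times> UNIV)" if "a \<in> interval1 W T h" "u \<in> Red W T a" for a u
    using Red_letter[OF that] by auto
  then show ?thesis unfolding dual_artin_rels_def by blast
qed

lemma artin_rels_lists: "artin_rels n m \<subseteq> words \<times> words"
proof -
  have "alt_word i j k \<in> words" if "i < n" "j < n" for i j k
    using that by (auto simp: alt_word_def)
  then show ?thesis unfolding artin_rels_def using less_trans by blast
qed

lemma dual_relation:
  assumes "a \<in> interval1 W T h" "u \<in> Red W T a" "v \<in> Red W T a"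
  shows "word_prod D (map dg u) = word_prod D (map dg v)"
proof -
  let ?R = "dual_artin_rels W T h"
  let ?p = "map (\<lambda>t. (t, True))"
  have rel: "(?p u, ?p v) \<in> ?R" using assms unfolding dual_artin_rels_def by blast
  then have l: "?p u \<in> lists (T\<^sub>h \<times> UNIV)" "?p v \<in> lists (T\<^sub>h \<times> UNIV)"
    using dual_artin_rels_lists by blast+
  have "pres_eq ?R (?p u) (?p v)"
    using pe_rel[OF rel, of "[]" "[]"] by simp
  then have "pclass T\<^sub>h ?R (?p u) = pclass T\<^sub>h ?R (?p v)"
    using l by (simp add: pclass_eq_iff)
  then show ?thesis
    unfolding pclass_eq_word_ev[OF l(1)] pclass_eq_word_ev[OF l(2)]
    by (simp add: word_ev_positive dual_artin_group_def)
qed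

text \<open>Adjacent letters of a reduced factorization of \<open>h\<close> multiply to an element
  below \<open>h\<close> of reflection length two, so any other pair of reflections with that
  product is reduced as well and a defining relation applies.\<close>

lemma dual_pair_relation:
  assumes red: "p @ x # y # q \<in> Red W T h"
    and T: "x' \<in> T" "y' \<in> T" and eq: "x' \<otimes>\<^bsub>W\<^esub> y' = x \<otimes>\<^bsub>W\<^esub> y"
  shows "dg x \<otimes>\<^bsub>D\<^esub> dg y = dg x' \<otimes>\<^bsub>D\<^esub> dg y'" "x' \<in> T\<^sub>h" "y' \<in> T\<^sub>h"
proof -
  have xy: "[x, y] \<in> Red W T (word_prod W [x, y])" "word_prod W [x, y] \<in> interval1 W T h"
    using Red_h_middle[of p "[x, y]" q] red by simp_all
  have c: "x \<in> carrier W" "y \<in> carrier W" "x' \<in> carrier W" "y' \<in> carrier W"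
    using xy(1) T T_carrier by (auto simp: Red_iff)
  then have x'y': "[x', y'] \<in> Red W T (word_prod W [x, y])"
    using xy(1) T eq by (simp add: Red_iff)
  show below: "x' \<in> T\<^sub>h" "y' \<in> T\<^sub>h" using Red_letter[OF xy(2) x'y'] by auto
  have "x \<in> T\<^sub>h" "y \<in> T\<^sub>h" using Red_letter[OF xy(2,1)] by auto
  then show "dg x \<otimes>\<^bsub>D\<^esub> dg y = dg x' \<otimes>\<^bsub>D\<^esub> dg y'"
    using dual_relation[OF xy(2,1) x'y'] below dg_carrier by simp
qed

text \<open>The map \<open>dg\<close> is not a homomorphism on \<open>W\<close>, but a Hurwitz move
  only replaces a neighbouring pair by another with the same product. The relation for these pairs
  turns conjugation in \<open>W\<close> into conjugation in \<open>D\<close>.\<close>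

lemma dual_hurwitz:
  assumes red: "xs \<in> Red W T h"
  shows "w \<in> lists ({1..<n} \<times> UNIV) \<Longrightarrow> map dg (hurwitz W w xs) = hurwitz D w (map dg xs)"
proof (induction w)
  case (Cons p w)
  let ?h = "hurwitz W w xs"
  have h: "?h \<in> Red W T h" using hurwitz_Red_h[OF red] Cons by simp
  then have "p \<in> {1..<length ?h} \<times> UNIV" using Cons by (simp add: Red_h_iff)
  then have "map dg (hurwitz_gen W p ?h) = hurwitz_gen D p (map dg ?h)"
  proof (cases rule: hurwitz_gen_cases)
    case (1 a x y b)
    let ?z = "x \<otimes>\<^bsub>W\<^esub> y \<otimes>\<^bsub>W\<^esub> inv\<^bsub>W\<^esub> x"
    have T: "x \<in> T" "y \<in> T" using h 1 by (simp_all add: Red_h_iff)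
    then have c: "x \<in> carrier W" "y \<in> carrier W" using T_carrier by auto
    have "?z \<otimes>\<^bsub>W\<^esub> x = x \<otimes>\<^bsub>W\<^esub> y" using c by (simp add: W.m_assoc)
    note rel = dual_pair_relation[OF h[unfolded 1] _ _ this]
    have below: "x \<in> T\<^sub>h" "y \<in> T\<^sub>h" using Red_h_letter[OF h] 1 by simp_all
    have "dg x \<otimes>\<^bsub>D\<^esub> dg y = dg ?z \<otimes>\<^bsub>D\<^esub> dg x" "?z \<in> T\<^sub>h" using rel T T_hurwitz by blast+
    then have "dg x \<otimes>\<^bsub>D\<^esub> dg y \<otimes>\<^bsub>D\<^esub> inv\<^bsub>D\<^esub> (dg x) = dg ?z"
      using below dg_carrier by (simp add: D.m_assoc)
    then show ?thesis
      using 1 hurwitz_gen_split(1)[of D "map dg a" "dg x" "dg y" "map dg b"] by simp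
  next
    case (2 a x y b)
    let ?z = "inv\<^bsub>W\<^esub> y \<otimes>\<^bsub>W\<^esub> x \<otimes>\<^bsub>W\<^esub> y"
    have T: "x \<in> T" "y \<in> T" using h 2 by (simp_all add: Red_h_iff)
    then have c: "x \<in> carrier W" "y \<in> carrier W" using T_carrier by auto
    have "y \<otimes>\<^bsub>W\<^esub> ?z = x \<otimes>\<^bsub>W\<^esub> y" using c by (simp add: W.group_normalize)
    note rel = dual_pair_relation[OF h[unfolded 2] _ _ this]
    have below: "x \<in> T\<^sub>h" "y \<in> T\<^sub>h" using Red_h_letter[OF h] 2 by simp_all
    have "dg x \<otimes>\<^bsub>D\<^esub> dg y = dg y \<otimes>\<^bsub>D\<^esub> dg ?z" "?z \<in> T\<^sub>h" using rel T T_hurwitz by blast+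
    then have "inv\<^bsub>D\<^esub> (dg y) \<otimes>\<^bsub>D\<^esub> dg x \<otimes>\<^bsub>D\<^esub> dg y = dg ?z"
      using below dg_carrier by (simp add: D.group_normalize)
    then show ?thesis
      using 2 hurwitz_gen_split(2)[of D "map dg a" "dg x" "dg y" "map dg b"] by simp
  qed
  then show ?case using Cons by simp
qed simp

text \<open>All neighbouring pairs of the dihedral sequence factor the product of \<open>s i\<close>
  and \<open>s j\<close>, which lies below \<open>h\<close>. Hence their images in \<open>D\<close>
  also have a constant product, and they inherit the period found in \<open>W\<close>.\<close>

lemma dual_artin_relation:
  assumes "(l, r) \<in> artin_rels n m"
  shows "word_ev D (\<lambda>i. dg (s i)) l = word_ev D (\<lambda>i. dg (s i)) r"
proof -
  obtain i j k where ij: "l = alt_word i j k" "r = alt_word j i k" "i < j" "j < n" "m i j = enat k"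
    using assms unfolding artin_rels_def by blast
  define x where "x = dihedral_seq W (s i) (s j)"
  define d where "d = s i \<otimes>\<^bsub>W\<^esub> s j"
  have x01: "x 0 = s i" "x (Suc 0) = s j" by (simp_all add: x_def)
  have sT: "s i \<in> T" "s j \<in> T" using s_T ij by auto
  have x: "x l \<in> T \<and> x (Suc l) \<in> T \<and> x l \<otimes>\<^bsub>W\<^esub> x (Suc l) = d" for l
  proof (induction l)
    case (Suc l)
    let ?a = "x l" and ?b = "x (Suc l)"
    have c: "?a \<in> carrier W" "?b \<in> carrier W" using Suc T_carrier by auto
    have b: "inv\<^bsub>W\<^esub> ?b = ?b" using Suc T_inv by blast
    have "x (Suc (Suc l)) = ?b \<otimes>\<^bsub>W\<^esub> ?a \<otimes>\<^bsub>W\<^esub> inv\<^bsub>W\<^esub> ?b" unfolding b by (simp add: x_def)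
    moreover have "?b \<otimes>\<^bsub>W\<^esub> (?b \<otimes>\<^bsub>W\<^esub> ?a \<otimes>\<^bsub>W\<^esub> ?b) = ?a \<otimes>\<^bsub>W\<^esub> ?b"
      using W.mult_inv_cancel(1)[of ?b] c unfolding b by (simp add: W.m_assoc)
    moreover have "?b \<otimes>\<^bsub>W\<^esub> ?a \<otimes>\<^bsub>W\<^esub> inv\<^bsub>W\<^esub> ?b \<in> T" using Suc T_conj c by blast
    ultimately show ?case using Suc b by simp
  qed (use sT x01 in \<open>simp add: d_def\<close>)
  then have xW: "x l \<in> carrier W" "x l \<otimes>\<^bsub>W\<^esub> x l = \<one>\<^bsub>W\<^esub>" "x l \<otimes>\<^bsub>W\<^esub> x (Suc l) = d" for l
    using T_carrier T_involution by blast+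
  have "d [^]\<^bsub>W\<^esub> k = \<one>\<^bsub>W\<^esub>" using s_mult_pow ij by (simp add: d_def)
  then have per: "x (if even k then Suc k else k) = x (if even k then 1 else 0)"
    by (rule W.constant_product_period[where x = x, OF xW(1,3,2)])
  obtain q where "[s i, s j] @ q \<in> Red W T h" using ij(3,4) by (rule s_pair_Red_h)
  then have q: "[] @ s i # s j # q \<in> Red W T h" by simp
  have dx: "dg (x l) \<in> carrier D" "dg (x l) \<otimes>\<^bsub>D\<^esub> dg (x (Suc l)) = dg (s i) \<otimes>\<^bsub>D\<^esub> dg (s j)" for l
    using dual_pair_relation[OF q, of "x l" "x (Suc l)"] x[of l] dg_carrier d_def by auto
  show ?thesis unfolding ij
    by (rule D.constant_product_artin_relation[where x = "\<lambda>l. dg (x l)", OF dx]) (use per x01 in \<open>simp_all split: if_splits\<close>)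
qed

text \<open>One braid word is applied to both generator tuples simultaneously. Formulating this as a
  relation postpones the question whether the lift depends on the word.\<close>

definition lift_rel :: "'g list \<Rightarrow> nat word set list \<Rightarrow> bool" where
  "lift_rel xs ys \<longleftrightarrow> (\<exists>w \<in> lists ({1..<n} \<times> UNIV).
     hurwitz W w (map s [0..<n]) = xs \<and> hurwitz A w (map ag [0..<n]) = ys)"

lemma lift_rel_hurwitz:
  assumes "lift_rel xs ys" "w \<in> lists ({1..<n} \<times> UNIV)"
  shows "lift_rel (hurwitz W w xs) (hurwitz A w ys)"
proof -
  obtain v where v: "v \<in> lists ({1..<n} \<times> UNIV)" "hurwitz W v (map s [0..<n]) = xs"
      "hurwitz A v (map ag [0..<n]) = ys"
    using assms(1) unfolding lift_rel_def by blast
  have "w @ v \<in> lists ({1..<n} \<times> UNIV)" using v assms by simp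
  then show ?thesis unfolding lift_rel_def
    by (rule bexI[rotated]) (simp add: hurwitz_word_append v)
qed

lemma lift_rel_length: "lift_rel xs ys \<Longrightarrow> length xs = n \<and> length ys = n"
  by (auto simp: lift_rel_def)

lemma lift_rel_Red: "lift_rel xs ys \<Longrightarrow> xs \<in> Red W T h"
  using hurwitz_Red_h[OF s_Red_h] unfolding lift_rel_def by blast

lemma ag_list_carrier: "set (map ag [0..<n]) \<subseteq> carrier A"
  using ag_carrier by auto

lemma lift_rel_carrier: "lift_rel xs ys \<Longrightarrow> set ys \<subseteq> carrier A"
  using A.hurwitz_carrier[OF ag_list_carrier] unfolding lift_rel_def by auto

text \<open>An inverse braid generator moves the right entry of a pair one place to the left
  unchanged, in \<open>W\<close> and in \<open>A\<close> alike, so a letter and its lift travel to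
  the front together.\<close>

lemma lift_rel_front:
  "lift_rel xs ys \<Longrightarrow> p < n \<Longrightarrow>
    \<exists>xs' ys'. lift_rel xs' ys' \<and> xs' ! 0 = xs ! p \<and> ys' ! 0 = ys ! p"
proof (induction p arbitrary: xs ys)
  case (Suc p)
  let ?xs = "hurwitz W [(Suc p, False)] xs" and ?ys = "hurwitz A [(Suc p, False)] ys"
  have l: "length xs = n" "length ys = n" using Suc lift_rel_length by auto
  have "lift_rel ?xs ?ys" using Suc by (intro lift_rel_hurwitz) auto
  then obtain xs' ys' where "lift_rel xs' ys'" "xs' ! 0 = ?xs ! p" "ys' ! 0 = ?ys ! p"
    using Suc by (meson Suc_lessD)
  moreover have "?xs ! p = xs ! Suc p" "?ys ! p = ys ! Suc p"
    using l Suc.prems by (simp_all add: hurwitz_gen.simps)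
  ultimately show ?case by auto
qed blast

end

section \<open>Lifts of single reflections and the isomorphism\<close>

locale dual_coxeter_sys = coxeter_sys W n s m
  for W :: "('g, 'b) monoid_scheme" and n s m +
  assumes well_stabilized: "well_stabilized W n s m"
    and pan_transitive: "pan_transitive W T h"
begin

lemma braid_word:
  assumes "a \<in> interval1 W T h" "u \<in> Red W T a" "v \<in> Red W T a"
  obtains w where "w \<in> lists ({1..<length u} \<times> UNIV)" "hurwitz W w u = v"
proof -
  obtain \<beta> w where "\<beta> \<in> carrier (braid_group (length u))" "w \<in> \<beta>" "hurwitz W w u = v"
    using pan_transitive assms unfolding pan_transitive_def by (metis Red_iff)
  moreover from this have "w \<in> lists ({1..<length u} \<times> UNIV)"
    unfolding braid_group_def carrier_pres_group pclass_def by blast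
  ultimately show thesis using that by blast
qed

lemma lift_rel_total:
  assumes "xs \<in> Red W T h"
  obtains ys where "lift_rel xs ys"
proof -
  obtain w where "w \<in> lists ({1..<length (map s [0..<n])} \<times> UNIV)" "hurwitz W w (map s [0..<n]) = xs"
    using braid_word[OF h_interval s_Red_h assms] .
  then have "lift_rel xs (hurwitz A w (map ag [0..<n]))"
    unfolding lift_rel_def by (intro bexI[of _ w]) simp_all
  then show thesis by (rule that)
qed

text \<open>Two words producing the same factorization differ by a braid fixing the tuple of simple
  reflections. By well-stabilization that braid also fixes the tuple of Artin generators.\<close>

lemma lift_rel_functional:
  assumes "lift_rel xs ys" "lift_rel xs ys'"
  shows "ys = ys'"
proof -
  let ?S = "map s [0..<n]" and ?S' = "map ag [0..<n]"
  have S: "set ?S \<subseteq> carrier W" "length ?S = n" using s_carrier by auto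
  note S' = ag_list_carrier
  obtain w where w: "w \<in> lists ({1..<n} \<times> UNIV)" "hurwitz W w ?S = xs" "hurwitz A w ?S' = ys"
    using assms(1) unfolding lift_rel_def by blast
  obtain w' where w': "w' \<in> lists ({1..<n} \<times> UNIV)" "hurwitz W w' ?S = xs" "hurwitz A w' ?S' = ys'"
    using assms(2) unfolding lift_rel_def by blast
  have wn: "winv w \<in> lists ({1..<n} \<times> UNIV)" using w(1) by (rule winv_lists)
  then have ww': "winv w @ w' \<in> lists ({1..<n} \<times> UNIV)" using w'(1) by simp
  have "hurwitz W (winv w) xs = ?S" using W.hurwitz_winv[OF S(1), of w] w by simp
  then have "hurwitz W (winv w @ w') ?S = ?S" by (simp add: hurwitz_word_append w')
  then have "pclass {1..<n} (braid_rels n) (winv w @ w') \<in> hurwitz_stab A n ?S'"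
    using W.pclass_mem_hurwitz_stab[OF S(2,1) ww'] well_stabilized unfolding well_stabilized_def by blast
  then have "hurwitz A (winv w @ w') ?S' = ?S'"
    using A.pclass_mem_hurwitz_stab[OF _ S' ww'] by simp
  then have fixed: "hurwitz A (winv w) ys' = ?S'" by (simp add: hurwitz_word_append w')
  have "ys = hurwitz A (winv (winv w)) (hurwitz A (winv w) ys')"
    by (simp add: fixed w(3))
  also have "\<dots> = ys'"
    using lift_rel_carrier[OF assms(2)] lift_rel_length[OF assms(2)] wn
    by (intro A.hurwitz_winv) simp_all
  finally show ?thesis .
qed

text \<open>Transitivity on reduced factorizations of the remaining product shows that the lift of a letter does not
  depend on the factorization it occurs in.\<close>

lemma lift_rel_head_unique:
  assumes l: "lift_rel xs ys" and l': "lift_rel xs' ys'" and eq: "xs ! 0 = xs' ! 0" and n: "0 < n"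
  shows "ys ! 0 = ys' ! 0"
proof -
  obtain t zs where xs: "xs = t # zs" using lift_rel_length[OF l] n by (cases xs) auto
  obtain t' zs' where xs': "xs' = t' # zs'" using lift_rel_length[OF l'] n by (cases xs') auto
  obtain g gs where ys: "ys = g # gs" using lift_rel_length[OF l] n by (cases ys) auto
  have t: "t' = t" using eq xs xs' by simp
  have r: "[t] @ zs \<in> Red W T h" "[t] @ zs' \<in> Red W T h"
    using lift_rel_Red[OF l] lift_rel_Red[OF l'] xs xs' t by simp_all
  \<comment> \<open>Both tails factor the complement of the common first letter \<open>t\<close> in
    \<open>h\<close>, which again lies below \<open>h\<close>, so transitivity applies to
    them.\<close>
  have "zs \<in> Red W T (word_prod W zs)" "word_prod W zs \<in> interval1 W T h"
    "zs' \<in> Red W T (word_prod W zs)"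
    using Red_h_middle[of "[t]" zs "[]"] Red_h_prefix(2,4)[OF r(1)] Red_h_prefix(2,4)[OF r(2)] r by simp_all
  then obtain w where w: "w \<in> lists ({1..<length zs} \<times> UNIV)" "hurwitz W w zs = zs'"
    using braid_word by blast
  have len: "Suc (length zs) = n" "length gs = length zs" using lift_rel_length[OF l] xs ys by auto
  then have "lift_rel (hurwitz W (shift_word w) xs) (hurwitz A (shift_word w) ys)"
    using shift_word_lists[OF w(1)] by (intro lift_rel_hurwitz[OF l]) simp
  moreover have "hurwitz W (shift_word w) xs = xs'" using w xs xs' t by (simp add: hurwitz_shift)
  moreover have "hurwitz A (shift_word w) ys = g # hurwitz A w gs"
    unfolding ys by (rule hurwitz_shift) (use w len in simp)
  ultimately have "ys' = g # hurwitz A w gs" using lift_rel_functional l' by metis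
  then show ?thesis using ys by simp
qed

text \<open>The choice ranges over all lifts and all positions at which \<open>t\<close> occurs;
  uniqueness of the lift at the front makes it canonical for letters of reduced factorizations of
  \<open>h\<close>.\<close>

definition lift_letter :: "'g \<Rightarrow> nat word set" where
  "lift_letter t = (SOME g. \<exists>xs ys p. lift_rel xs ys \<and> p < n \<and> xs ! p = t \<and> ys ! p = g)"

lemma lift_letter_nth:
  assumes "lift_rel xs ys" "p < n"
  shows "lift_letter (xs ! p) = ys ! p"
proof -
  have "\<exists>xs' ys' p'. lift_rel xs' ys' \<and> p' < n \<and> xs' ! p' = xs ! p \<and> ys' ! p' = lift_letter (xs ! p)"
    unfolding lift_letter_def by (rule someI[of _ "ys ! p"]) (use assms in blast)
  then obtain xs' ys' p' where "lift_rel xs' ys'" "p' < n" "xs' ! p' = xs ! p"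
    "ys' ! p' = lift_letter (xs ! p)" by blast
  moreover have "0 < n" using assms(2) by simp
  ultimately show ?thesis
    using lift_rel_front[of xs ys p] lift_rel_front[of xs' ys' p'] assms lift_rel_head_unique by metis
qed

lemma map_lift_letter: "lift_rel xs ys \<Longrightarrow> map lift_letter xs = ys"
  using lift_rel_length lift_letter_nth by (intro nth_equalityI) auto

lemma lift_letter_carrier: "t \<in> T\<^sub>h \<Longrightarrow> lift_letter t \<in> carrier A"
proof -
  assume "t \<in> T\<^sub>h"
  then obtain xs where "t # xs \<in> Red W T h" by (rule Red_h_Cons_exists)
  then obtain ys where ys: "lift_rel (t # xs) ys" by (rule lift_rel_total)
  show ?thesis using map_lift_letter[OF ys] lift_rel_carrier[OF ys] by auto
qed

text \<open>After completing \<open>u\<close> to a factorization of \<open>h\<close>, a braid on the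
  first strands turns \<open>u\<close> into \<open>v\<close> and the lifted letters of
  \<open>u\<close> into those of \<open>v\<close>. Hurwitz moves preserve products.\<close>

lemma lift_letter_relation:
  assumes a: "a \<in> interval1 W T h" and u: "u \<in> Red W T a" and v: "v \<in> Red W T a"
  shows "word_prod A (map lift_letter u) = word_prod A (map lift_letter v)"
proof -
  have "inv\<^bsub>W\<^esub> a \<otimes>\<^bsub>W\<^esub> h \<in> carrier W" using a by (simp add: interval1_def)
  then obtain q where "q \<in> Red W T (inv\<^bsub>W\<^esub> a \<otimes>\<^bsub>W\<^esub> h)" by (rule Red_exists)
  with a u have uq: "u @ q \<in> Red W T h" by (rule Red_h_append)
  then obtain ys where "lift_rel (u @ q) ys" by (rule lift_rel_total)
  with map_lift_letter[OF this] have l: "lift_rel (u @ q) (map lift_letter u @ map lift_letter q)" by simp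
  obtain w where w: "w \<in> lists ({1..<length u} \<times> UNIV)" "hurwitz W w u = v"
    using braid_word[OF a u v] .
  have "length u \<le> n" using uq by (simp add: Red_h_iff)
  then have "w \<in> lists ({1..<n} \<times> UNIV)" using w(1) by fastforce
  note lift_rel_hurwitz[OF l this]
  moreover have "hurwitz W w (u @ q) = v @ q" using hurwitz_prefix[OF w(1)] w(2) by metis
  moreover have "hurwitz A w (map lift_letter u @ map lift_letter q) =
      hurwitz A w (map lift_letter u) @ map lift_letter q"
    using w(1) by (intro hurwitz_prefix) simp
  ultimately have "lift_rel (v @ q) (hurwitz A w (map lift_letter u) @ map lift_letter q)" by simp
  from map_lift_letter[OF this] have "map lift_letter v = hurwitz A w (map lift_letter u)" by simp
  moreover have "set (map lift_letter u) \<subseteq> carrier A"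
    using lift_rel_carrier[OF l] by simp
  ultimately show ?thesis using A.hurwitz_word_prod[of "map lift_letter u" w] w(1) by simp
qed

lemma artin_iso_dual: "A \<cong> D"
proof -
  have s_X: "s i \<in> T\<^sub>h" if "i < n" for i using Red_h_letter[OF s_Red_h, of "s i"] that by simp
  have f: "(\<lambda>i. dg (s i)) \<in> {..<n} \<rightarrow> carrier D" using s_X dg_carrier by blast
  obtain \<Phi> where \<Phi>: "\<Phi> \<in> hom (pres_group {..<n} (artin_rels n m)) D"
    and \<Phi>_ev: "\<And>w. w \<in> words \<Longrightarrow> \<Phi> (pclass {..<n} (artin_rels n m) w) = word_ev D (\<lambda>i. dg (s i)) w"
    by (rule pres_group_lift[OF D.is_group f artin_rels_lists dual_artin_relation]) (assumption, rule that)
  have g: "lift_letter \<in> T\<^sub>h \<rightarrow> carrier A" using lift_letter_carrier by blast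
  have rel: "word_ev A lift_letter l = word_ev A lift_letter r"
    if lr: "(l, r) \<in> dual_artin_rels W T h" for l r
  proof -
    obtain a u v where "l = map (\<lambda>t. (t, True)) u" "r = map (\<lambda>t. (t, True)) v"
      "a \<in> interval1 W T h" "u \<in> Red W T a" "v \<in> Red W T a"
      using lr unfolding dual_artin_rels_def by blast
    then show ?thesis using lift_letter_relation[of a u v] by (simp add: word_ev_positive)
  qed
  obtain \<Psi> where \<Psi>: "\<Psi> \<in> hom (pres_group T\<^sub>h (dual_artin_rels W T h)) A"
    and \<Psi>_ev: "\<And>w. w \<in> lists (T\<^sub>h \<times> UNIV) \<Longrightarrow> \<Psi> (pclass T\<^sub>h (dual_artin_rels W T h) w) = word_ev A lift_letter w"
    by (rule pres_group_lift[OF A.is_group g dual_artin_rels_lists rel]) (assumption, rule that)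
  interpret \<Phi>: group_hom A D \<Phi>
    using \<Phi> by unfold_locales (simp add: artin_group_def)
  interpret \<Psi>: group_hom D A \<Psi>
    using \<Psi> by unfold_locales (simp add: dual_artin_group_def)
  have \<Phi>_gen: "\<Phi> (ag i) = dg (s i)" if "i < n" for i
    using \<Phi>_ev[of "[(i, True)]"] that s_X dg_carrier by (simp add: artin_gen_def)
  have "lift_rel (map s [0..<n]) (map ag [0..<n])"
    unfolding lift_rel_def by (rule bexI[of _ "[]"]) simp_all
  then have lift_s: "lift_letter (s i) = ag i" if "i < n" for i
    using lift_letter_nth[of _ _ i] that by fastforce
  have \<Psi>_gen: "\<Psi> (dg (s i)) = ag i" if "i < n" for i
    using \<Psi>_ev[of "[(s i, True)]"] s_X[OF that] lift_s[OF that] ag_carrier[OF that] by simp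
  \<comment> \<open>It suffices to compare the composite with the identity on the Artin generators.
    This left inverse gives injectivity.\<close>
  have "\<Psi> (\<Phi> x) = x" if x: "x \<in> carrier A" for x
  proof -
    obtain w where w: "x = pclass {..<n} (artin_rels n m) w" "w \<in> words"
      using x unfolding artin_group_def carrier_pres_group by blast
    have "\<Psi> \<circ> \<Phi> \<in> hom (pres_group {..<n} (artin_rels n m)) A"
      using hom_compose[OF \<Phi>.homh \<Psi>.homh] by (simp add: artin_group_def)
    from hom_pclass[OF A.is_group this w(2)]
    have "\<Psi> (\<Phi> x) = word_ev A (\<lambda>i. \<Psi> (\<Phi> (ag i))) w"
      unfolding w(1) by (simp add: artin_gen_def)
    also have "\<dots> = word_ev A ag w"
      by (rule word_ev_cong[OF w(2)]) (simp add: \<Phi>_gen \<Psi>_gen)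
    also have "\<dots> = x"
      unfolding w(1) pclass_eq_word_ev[OF w(2)] by (simp add: artin_group_def artin_gen_def[abs_def])
    finally show ?thesis .
  qed
  then have inj: "inj_on \<Phi> (carrier A)" by (rule inj_on_inverseI)
  \<comment> \<open>Surjectivity: the tuple \<open>t # xs\<close> is a Hurwitz image of the simple
    reflections, and the same braid applied to the Artin generators gives a tuple that
    \<open>\<Phi>\<close> maps to \<open>map dg (t # xs)\<close>.\<close>
  have gen_image: "dg t \<in> \<Phi> ` carrier A" if t: "t \<in> T\<^sub>h" for t
  proof -
    obtain xs where xs: "t # xs \<in> Red W T h" using t by (rule Red_h_Cons_exists)
    obtain w where w: "w \<in> lists ({1..<n} \<times> UNIV)" "hurwitz W w (map s [0..<n]) = t # xs"
      using braid_word[OF h_interval s_Red_h xs] by auto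
    have "map dg (t # xs) = hurwitz D w (map dg (map s [0..<n]))"
      using dual_hurwitz[OF s_Red_h w(1)] w(2) by simp
    also have "map dg (map s [0..<n]) = map \<Phi> (map ag [0..<n])" using \<Phi>_gen by simp
    also have "hurwitz D w (map \<Phi> (map ag [0..<n])) = map \<Phi> (hurwitz A w (map ag [0..<n]))"
      using w(1) by (intro hurwitz_map_hom[symmetric] \<Phi>.group_hom_axioms ag_list_carrier) simp
    finally have eq: "map dg (t # xs) = map \<Phi> (hurwitz A w (map ag [0..<n]))" .
    have "dg t \<in> set (map dg (t # xs))" by simp
    then have "dg t \<in> \<Phi> ` set (hurwitz A w (map ag [0..<n]))" unfolding eq set_map .
    then show ?thesis using A.hurwitz_carrier[OF ag_list_carrier, of w] w(1) by auto
  qed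
  have sub: "subgroup (\<Phi> ` carrier A) D" by (rule \<Phi>.img_is_subgroup)
  have "word_ev D dg w \<in> \<Phi> ` carrier A" if "w \<in> lists (T\<^sub>h \<times> UNIV)" for w
    using that
  proof (induction w)
    case Nil
    then show ?case using subgroup.one_closed[OF sub] by simp
  next
    case (Cons p w)
    then obtain t b where p: "p = (t, b)" "t \<in> T\<^sub>h" by force
    then show ?case
      using Cons gen_image[OF p(2)] subgroup.m_closed[OF sub] subgroup.m_inv_closed[OF sub] by auto
  qed
  moreover have "pclass T\<^sub>h (dual_artin_rels W T h) w = word_ev D dg w" if "w \<in> lists (T\<^sub>h \<times> UNIV)" for w
    unfolding dual_artin_group_def by (rule pclass_eq_word_ev[OF that])
  ultimately have image: "pclass T\<^sub>h (dual_artin_rels W T h) w \<in> \<Phi> ` carrier A"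
    if "w \<in> lists (T\<^sub>h \<times> UNIV)" for w
    using that by metis
  have "carrier D = {pclass T\<^sub>h (dual_artin_rels W T h) w | w. w \<in> lists (T\<^sub>h \<times> UNIV)}"
    unfolding dual_artin_group_def by (rule carrier_pres_group)
  then have "carrier D \<subseteq> \<Phi> ` carrier A" by (auto intro!: image)
  then have "\<Phi> ` carrier A = carrier D" using \<Phi>.hom_closed by blast
  then have "\<Phi> \<in> iso A D" using inj \<Phi>.homh by (simp add: iso_def bij_betw_def)
  then show ?thesis by (rule is_isoI)
qed

end

theorem theorem3p11:
  fixes W :: "('g, 'b) monoid_scheme" and n :: nat and s :: "nat \<Rightarrow> 'g"
    and m :: "nat \<Rightarrow> nat \<Rightarrow> enat"
  assumes "coxeter_system W n s m"
    and "well_stabilized W n s m"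
    and "pan_transitive W (reflections W n s) (word_prod W (map s [0..<n]))"
  shows "artin_group n m \<cong>
           dual_artin_group W (reflections W n s) (word_prod W (map s [0..<n]))"
proof -
  interpret dual_coxeter_sys W n s m
    using assms by unfold_locales
  show ?thesis by (rule artin_iso_dual)
qed

end
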